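(* Let $T$ be a multiplier bimonad on a monoidal category $\mathcal C$. Assume that $T_0:TI\to I$ and, for any objects $X$ and $Y$, the equal morphisms $$\big(T(TX\otimes TY)\xrightarrow{\hat T_2}T^2X\otimes TY\xrightarrow{\hat T_2\otimes 1}TI\otimes TX\otimes TY\xrightarrow{T_0\otimes 1\otimes 1}TX\otimes TY\big)=$$ $$\big(T(TX\otimes TY)\xrightarrow{\check T_2}TX\otimes T^2Y\xrightarrow{1\otimes\check T_2}TX\otimes TY\otimes TI\xrightarrow{1\otimes 1\otimes T_0}TX\otimes TY\big)$$ are split epimorphisms. Then the category of $T$-modules is monoidal in such a way that the forgetful functor to $\mathcal C$, $(Q,\hat q,\check q)\mapsto Q$, is strict monoidal.
   Context: Conventions: $\otimes$ is the monoidal product, $I$ the unit; composition is juxtaposition, $1$ denotes identities, associativity and unit isomorphisms are suppressed. A *multiplier bimonad* on $\mathcal C$ is a functor $T:\mathcal C\to\mathcal C$ with natural transformations $\hat T_2:T(X\otimes TY)\to TX\otimes TY$ and $\check T_2:T(TX\otimes Y)\to TX\otimes TY$ and a morphism $T_0:TI\to I$ such that for all objects $X,Y,Z$: - (left multiplier bimonad) $(\hat T_2\otimes 1)\hat T_2\,T(1\otimes\hat T_2)=(1\otimes\hat T_2)\hat T_2:T(X\otimes T(Y\otimes TZ))\to TX\otimes TY\otimes TZ$ and $(1\otimes T_0)\hat T_2=T(1\otimes T_0):T(X\otimes TI)\to TX$; - (right multiplier bimonad) $(1\otimes\check T_2)\check T_2\,T(\check T_2\otimes 1)=(\check T_2\otimes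 1)\check T_2:T(T(TX\otimes Y)\otimes Z)\to TX\otimes TY\otimes TZ$ and $(T_0\otimes 1)\check T_2=T(T_0\otimes 1):T(TI\otimes X)\to TX$; - $(1\otimes\hat T_2)\check T_2=(\check T_2\otimes 1)\hat T_2:T(TX\otimes Y\otimes TZ)\to TX\otimes TY\otimes TZ$; - $(T_0\otimes 1)\hat T_2=(1\otimes T_0)\check T_2:T^2X\to TX$ (with $\hat T_2:T^2X\to TI\otimes TX$ and $\check T_2:T^2X\to TX\otimes TI$). These compatibilities imply that the two composites displayed in the claim are equal. A *module* over the multiplier bimonad $T$ is an object $Q$ with natural transformations $\hat q:T(-\otimes Q)\to T(-)\otimes Q$ and $\check q:T(Q\otimes -)\to Q\otimes T(-)$ such that for all objects $X,Y$: - $(\hat T_2\otimes 1)\hat q\,T(1\otimes\hat q)=(1\otimes\hat q)\hat T_2:T(X\otimes T(Y\otimes Q))\to TX\otimes TY\otimes Q$, and $(T_0\otimes 1)\hat q:TQ\to TI\otimes Q\to Q$ is a split epimorphism; - $(1\otimes\check T_2)\check q\,T(\check q\otimes 1)=(\check q\otimes 1)\check T_2:T(T(Q\otimes X)\otimes Y)\to Q\otimes TX\otimes TY$, and $(1\otimes T_0)\check q:TQ\to Q\otimes TI\to Q$ is a split epimorphism; - $(\check T_2\otimes 1)\hat q=(1\otimes\hat q)\check T_2:T(TX\otimes Y\otimes Q)\to TX\otimes TY\otimes Q$; - $(1\otimes\hat T_2)\check q=(\check q\otimes 1)\hat T_2:T(Q\otimes X\otimes TY)\to Q\otimes TX\otimes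 TY$; - $(T_0\otimes 1)\hat q=(1\otimes T_0)\check q:TQ\to Q$. A *morphism* of modules $(Q,\hat q,\check q)\to(P,\hat p,\check p)$ is a morphism $f:Q\to P$ in $\mathcal C$ such that $(1\otimes f)\hat q=\hat p\,T(1\otimes f):T(X\otimes Q)\to TX\otimes P$ and $(f\otimes 1)\check q=\check p\,T(f\otimes 1):T(Q\otimes X)\to P\otimes TX$ for all objects $X$. *)

theory Defs
  imports "HOL-Library.FuncSet"
begin

section \<open>Categories, functors, natural transformations\<close>

record ('o, 'a) cat =
  Obj :: "'o set"
  Arr :: "'a set"
  Dom :: "'a \<Rightarrow> 'o"
  Cod :: "'a \<Rightarrow> 'o"
  Idn :: "'o \<Rightarrow> 'a"  ("\<one>\<index>")
  Comp :: "'a \<Rightarrow> 'a \<Rightarrow> 'a"  (infixr "\<cdot>\<index>" 55)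

definition hom :: "('o, 'a, 'z) cat_scheme \<Rightarrow> 'o \<Rightarrow> 'o \<Rightarrow> 'a set" where
  "hom C X Y = {f \<in> Arr C. Dom C f = X \<and> Cod C f = Y}"

text \<open>Composition is written in the classical order: \<open>g \<cdot> f\<close> means first \<open>f\<close>, then \<open>g\<close>.\<close>

locale category =
  fixes C :: "('o, 'a, 'z) cat_scheme" (structure)
  assumes Dom_in_Obj: "f \<in> Arr C \<Longrightarrow> Dom C f \<in> Obj C"
    and Cod_in_Obj: "f \<in> Arr C \<Longrightarrow> Cod C f \<in> Obj C"
    and Idn_in_hom: "X \<in> Obj C \<Longrightarrow> \<one> X \<in> hom C X X"
    and Comp_in_hom: "f \<in> hom C X Y \<Longrightarrow> g \<in> hom C Y Z \<Longrightarrow> g \<cdot> f \<in> hom C X Z"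
    and Comp_Idn: "f \<in> hom C X Y \<Longrightarrow> f \<cdot> \<one> X = f"
    and Idn_Comp: "f \<in> hom C X Y \<Longrightarrow> \<one> Y \<cdot> f = f"
    and Comp_assoc: "f \<in> hom C W X \<Longrightarrow> g \<in> hom C X Y \<Longrightarrow> h \<in> hom C Y Z \<Longrightarrow>
          (h \<cdot> g) \<cdot> f = h \<cdot> (g \<cdot> f)"

definition inverse_arrows :: "('o, 'a, 'z) cat_scheme \<Rightarrow> 'a \<Rightarrow> 'a \<Rightarrow> bool" where
  "inverse_arrows C f g \<longleftrightarrow> f \<in> Arr C \<and> g \<in> hom C (Cod C f) (Dom C f) \<and>
     g \<cdot>\<^bsub>C\<^esub> f = \<one>\<^bsub>C\<^esub> (Dom C f) \<and> f \<cdot>\<^bsub>C\<^esub> g = \<one>\<^bsub>C\<^esub> (Cod C f)"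

definition is_iso :: "('o, 'a, 'z) cat_scheme \<Rightarrow> 'a \<Rightarrow> bool" where
  "is_iso C f \<longleftrightarrow> (\<exists>g. inverse_arrows C f g)"

definition inv_arr :: "('o, 'a, 'z) cat_scheme \<Rightarrow> 'a \<Rightarrow> 'a" where
  "inv_arr C f = (THE g. inverse_arrows C f g)"

definition split_epi :: "('o, 'a, 'z) cat_scheme \<Rightarrow> 'a \<Rightarrow> bool" where
  "split_epi C f \<longleftrightarrow> f \<in> Arr C \<and>
     (\<exists>s \<in> hom C (Cod C f) (Dom C f). f \<cdot>\<^bsub>C\<^esub> s = \<one>\<^bsub>C\<^esub> (Cod C f))"

definition prod_cat :: "('o, 'a, 'z) cat_scheme \<Rightarrow> ('p, 'b, 'y) cat_scheme \<Rightarrow>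
    ('o \<times> 'p, 'a \<times> 'b) cat"  (infixr "\<times>\<^sub>c" 70) where
  "C \<times>\<^sub>c D =
    \<lparr> Obj = Obj C \<times> Obj D,
      Arr = Arr C \<times> Arr D,
      Dom = (\<lambda>(f, g). (Dom C f, Dom D g)),
      Cod = (\<lambda>(f, g). (Cod C f, Cod D g)),
      Idn = (\<lambda>(X, Y). (\<one>\<^bsub>C\<^esub> X, \<one>\<^bsub>D\<^esub> Y)),
      Comp = (\<lambda>(f', g') (f, g). (f' \<cdot>\<^bsub>C\<^esub> f, g' \<cdot>\<^bsub>D\<^esub> g)) \<rparr>"

locale cat_functor = dom: category C + cod: category D
  for C :: "('o, 'a, 'z) cat_scheme" and D :: "('p, 'b, 'y) cat_scheme" +
  fixes Fo :: "'o \<Rightarrow> 'p" and Fa :: "'a \<Rightarrow> 'b"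
  assumes map_Obj: "X \<in> Obj C \<Longrightarrow> Fo X \<in> Obj D"
    and map_hom: "f \<in> hom C X Y \<Longrightarrow> Fa f \<in> hom D (Fo X) (Fo Y)"
    and map_Idn: "X \<in> Obj C \<Longrightarrow> Fa (\<one>\<^bsub>C\<^esub> X) = \<one>\<^bsub>D\<^esub> (Fo X)"
    and map_Comp: "f \<in> hom C X Y \<Longrightarrow> g \<in> hom C Y Z \<Longrightarrow>
          Fa (g \<cdot>\<^bsub>C\<^esub> f) = Fa g \<cdot>\<^bsub>D\<^esub> Fa f"

locale natural_transformation = F: cat_functor C D Fo Fa + G: cat_functor C D Go Ga
  for C :: "('o, 'a, 'z) cat_scheme" and D :: "('p, 'b, 'y) cat_scheme"
    and Fo Fa Go Ga +
  fixes t :: "'o \<Rightarrow> 'b"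
  assumes component_in_hom: "X \<in> Obj C \<Longrightarrow> t X \<in> hom D (Fo X) (Go X)"
    and naturality: "f \<in> hom C X Y \<Longrightarrow> t Y \<cdot>\<^bsub>D\<^esub> Fa f = Ga f \<cdot>\<^bsub>D\<^esub> t X"

locale natural_isomorphism = natural_transformation +
  assumes component_iso: "X \<in> Obj C \<Longrightarrow> is_iso D (t X)"


section \<open>Monoidal categories and strict monoidal functors\<close>

text \<open>
  The symbol \<open>\<otimes>\<close> is the monoidal product of objects, \<open>\<odot>\<close> that of arrows.  The constraints are
  \<open>\<a> X Y Z : (X \<otimes> Y) \<otimes> Z \<rightarrow> X \<otimes> (Y \<otimes> Z)\<close>, \<open>\<l> X : \<I> \<otimes> X \<rightarrow> X\<close> and \<open>\<r> X : X \<otimes> \<I> \<rightarrow> X\<close>.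
  Monoidal categories are not assumed to be strict.
\<close>

record ('o, 'a) moncat = "('o, 'a) cat" +
  TensO :: "'o \<Rightarrow> 'o \<Rightarrow> 'o"  (infixr "\<otimes>\<index>" 70)
  TensA :: "'a \<Rightarrow> 'a \<Rightarrow> 'a"  (infixr "\<odot>\<index>" 70)
  UnitO :: "'o"  ("\<I>\<index>")
  Assoc :: "'o \<Rightarrow> 'o \<Rightarrow> 'o \<Rightarrow> 'a"  ("\<a>\<index>")
  Lunit :: "'o \<Rightarrow> 'a"  ("\<l>\<index>")
  Runit :: "'o \<Rightarrow> 'a"  ("\<r>\<index>")

locale monoidal_category = category C
  for C :: "('o, 'a, 'z) moncat_scheme" (structure) +
  assumes tensor_functor:
      "cat_functor (C \<times>\<^sub>c C) C (\<lambda>(X, Y). X \<otimes> Y) (\<lambda>(f, g). f \<odot> g)"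
    and UnitO_in_Obj: "\<I> \<in> Obj C"
    and Assoc_natural_iso:
      "natural_isomorphism (C \<times>\<^sub>c C \<times>\<^sub>c C) C
         (\<lambda>(X, Y, Z). (X \<otimes> Y) \<otimes> Z) (\<lambda>(f, g, h). (f \<odot> g) \<odot> h)
         (\<lambda>(X, Y, Z). X \<otimes> (Y \<otimes> Z)) (\<lambda>(f, g, h). f \<odot> (g \<odot> h))
         (\<lambda>(X, Y, Z). \<a> X Y Z)"
    and Lunit_natural_iso:
      "natural_isomorphism C C (\<lambda>X. \<I> \<otimes> X) (\<lambda>f. \<one> \<I> \<odot> f) (\<lambda>X. X) (\<lambda>f. f) (\<lambda>X. \<l> X)"
    and Runit_natural_iso:
      "natural_isomorphism C C (\<lambda>X. X \<otimes> \<I>) (\<lambda>f. f \<odot> \<one> \<I>) (\<lambda>X. X) (\<lambda>f. f) (\<lambda>X. \<r> X)"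
    and pentagon:
      "\<lbrakk> W \<in> Obj C; X \<in> Obj C; Y \<in> Obj C; Z \<in> Obj C \<rbrakk> \<Longrightarrow>
         (\<one> W \<odot> \<a> X Y Z) \<cdot> \<a> W (X \<otimes> Y) Z \<cdot> (\<a> W X Y \<odot> \<one> Z)
         = \<a> W X (Y \<otimes> Z) \<cdot> \<a> (W \<otimes> X) Y Z"
    and triangle:
      "\<lbrakk> X \<in> Obj C; Y \<in> Obj C \<rbrakk> \<Longrightarrow> (\<one> X \<odot> \<l> Y) \<cdot> \<a> X \<I> Y = \<r> X \<odot> \<one> Y"

text \<open>Strictness means that the structure morphisms \<open>FX \<otimes> FY \<rightarrow> F(X \<otimes> Y)\<close> and \<open>\<I> \<rightarrow> F \<I>\<close> are
  identities; the coherence conditions of a monoidal functor then say that \<open>F\<close> preserves the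
  associativity and unit constraints.\<close>

locale strict_monoidal_functor =
  dom: monoidal_category C + cod: monoidal_category D + cat_functor C D Fo Fa
  for C :: "('o, 'a, 'z) moncat_scheme" and D :: "('p, 'b, 'y) moncat_scheme" and Fo Fa +
  assumes map_TensO: "X \<in> Obj C \<Longrightarrow> Y \<in> Obj C \<Longrightarrow> Fo (X \<otimes>\<^bsub>C\<^esub> Y) = Fo X \<otimes>\<^bsub>D\<^esub> Fo Y"
    and map_TensA: "f \<in> Arr C \<Longrightarrow> g \<in> Arr C \<Longrightarrow> Fa (f \<odot>\<^bsub>C\<^esub> g) = Fa f \<odot>\<^bsub>D\<^esub> Fa g"
    and map_UnitO: "Fo \<I>\<^bsub>C\<^esub> = \<I>\<^bsub>D\<^esub>"
    and map_Assoc: "X \<in> Obj C \<Longrightarrow> Y \<in> Obj C \<Longrightarrow> Z \<in> Obj C \<Longrightarrow>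
          Fa (\<a>\<^bsub>C\<^esub> X Y Z) = \<a>\<^bsub>D\<^esub> (Fo X) (Fo Y) (Fo Z)"
    and map_Lunit: "X \<in> Obj C \<Longrightarrow> Fa (\<l>\<^bsub>C\<^esub> X) = \<l>\<^bsub>D\<^esub> (Fo X)"
    and map_Runit: "X \<in> Obj C \<Longrightarrow> Fa (\<r>\<^bsub>C\<^esub> X) = \<r>\<^bsub>D\<^esub> (Fo X)"


section \<open>Multiplier bimonads\<close>

text \<open>
  The functor \<open>T\<close> is given by its object map \<open>To\<close> and its arrow map \<open>Ta\<close>.
  The suppressed associativity and unit isomorphisms are restored throughout, so that both sides
  of every equation below are parallel arrows of \<open>C\<close>.
\<close>

locale multiplier_bimonad =
  monoidal_category C +
  T: cat_functor C C To Ta +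
  hat: natural_transformation "C \<times>\<^sub>c C" C
    "\<lambda>(X, Y). To (X \<otimes>\<^bsub>C\<^esub> To Y)" "\<lambda>(f, g). Ta (f \<odot>\<^bsub>C\<^esub> Ta g)"
    "\<lambda>(X, Y). To X \<otimes>\<^bsub>C\<^esub> To Y" "\<lambda>(f, g). Ta f \<odot>\<^bsub>C\<^esub> Ta g"
    "\<lambda>(X, Y). T2h X Y" +
  check: natural_transformation "C \<times>\<^sub>c C" C
    "\<lambda>(X, Y). To (To X \<otimes>\<^bsub>C\<^esub> Y)" "\<lambda>(f, g). Ta (Ta f \<odot>\<^bsub>C\<^esub> g)"
    "\<lambda>(X, Y). To X \<otimes>\<^bsub>C\<^esub> To Y" "\<lambda>(f, g). Ta f \<odot>\<^bsub>C\<^esub> Ta g"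
    "\<lambda>(X, Y). T2c X Y"
  for C :: "('o, 'a, 'z) moncat_scheme" (structure)
    and To :: "'o \<Rightarrow> 'o" and Ta :: "'a \<Rightarrow> 'a"
    and T2h :: "'o \<Rightarrow> 'o \<Rightarrow> 'a" and T2c :: "'o \<Rightarrow> 'o \<Rightarrow> 'a" +
  fixes T0 :: "'a"
  assumes T0_in_hom: "T0 \<in> hom C (To \<I>) \<I>"
    and T2h_coassoc: "\<lbrakk> X \<in> Obj C; Y \<in> Obj C; Z \<in> Obj C \<rbrakk> \<Longrightarrow>
          \<a> (To X) (To Y) (To Z) \<cdot> (T2h X Y \<odot> \<one> (To Z)) \<cdot> T2h (X \<otimes> To Y) Z
            \<cdot> Ta (inv_arr C (\<a> X (To Y) (To Z))) \<cdot> Ta (\<one> X \<odot> T2h Y Z)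
          = (\<one> (To X) \<odot> T2h Y Z) \<cdot> T2h X (Y \<otimes> To Z)"
    and T2h_counit: "X \<in> Obj C \<Longrightarrow>
          \<r> (To X) \<cdot> (\<one> (To X) \<odot> T0) \<cdot> T2h X \<I> = Ta (\<r> X \<cdot> (\<one> X \<odot> T0))"
    and T2c_coassoc: "\<lbrakk> X \<in> Obj C; Y \<in> Obj C; Z \<in> Obj C \<rbrakk> \<Longrightarrow>
          (\<one> (To X) \<odot> T2c Y Z) \<cdot> T2c X (To Y \<otimes> Z)
            \<cdot> Ta (\<a> (To X) (To Y) Z) \<cdot> Ta (T2c X Y \<odot> \<one> Z)
          = \<a> (To X) (To Y) (To Z) \<cdot> (T2c X Y \<odot> \<one> (To Z)) \<cdot> T2c (To X \<otimes> Y) Z"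
    and T2c_counit: "X \<in> Obj C \<Longrightarrow>
          \<l> (To X) \<cdot> (T0 \<odot> \<one> (To X)) \<cdot> T2c \<I> X = Ta (\<l> X \<cdot> (T0 \<odot> \<one> X))"
    and T2h_T2c: "\<lbrakk> X \<in> Obj C; Y \<in> Obj C; Z \<in> Obj C \<rbrakk> \<Longrightarrow>
          (\<one> (To X) \<odot> T2h Y Z) \<cdot> T2c X (Y \<otimes> To Z) \<cdot> Ta (\<a> (To X) Y (To Z))
          = \<a> (To X) (To Y) (To Z) \<cdot> (T2c X Y \<odot> \<one> (To Z)) \<cdot> T2h (To X \<otimes> Y) Z"
    and T2h_T2c_counit: "X \<in> Obj C \<Longrightarrow>
          \<l> (To X) \<cdot> (T0 \<odot> \<one> (To X)) \<cdot> T2h \<I> X \<cdot> Ta (inv_arr C (\<l> (To X)))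
          = \<r> (To X) \<cdot> (\<one> (To X) \<odot> T0) \<cdot> T2c X \<I> \<cdot> Ta (inv_arr C (\<r> (To X)))"


section \<open>The category of modules\<close>

locale multiplier_bimonad_module =
  multiplier_bimonad C To Ta T2h T2c T0 +
  qh: natural_transformation C C
    "\<lambda>X. To (X \<otimes>\<^bsub>C\<^esub> Q)" "\<lambda>f. Ta (f \<odot>\<^bsub>C\<^esub> \<one>\<^bsub>C\<^esub> Q)"
    "\<lambda>X. To X \<otimes>\<^bsub>C\<^esub> Q" "\<lambda>f. Ta f \<odot>\<^bsub>C\<^esub> \<one>\<^bsub>C\<^esub> Q" qh +
  qc: natural_transformation C C
    "\<lambda>X. To (Q \<otimes>\<^bsub>C\<^esub> X)" "\<lambda>f. Ta (\<one>\<^bsub>C\<^esub> Q \<odot>\<^bsub>C\<^esub> f)"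
    "\<lambda>X. Q \<otimes>\<^bsub>C\<^esub> To X" "\<lambda>f. \<one>\<^bsub>C\<^esub> Q \<odot>\<^bsub>C\<^esub> Ta f" qc
  for C :: "('o, 'a, 'z) moncat_scheme" (structure)
    and To :: "'o \<Rightarrow> 'o" and Ta :: "'a \<Rightarrow> 'a"
    and T2h :: "'o \<Rightarrow> 'o \<Rightarrow> 'a" and T2c :: "'o \<Rightarrow> 'o \<Rightarrow> 'a" and T0 :: "'a"
    and Q :: "'o" and qh :: "'o \<Rightarrow> 'a" and qc :: "'o \<Rightarrow> 'a" +
  assumes Q_in_Obj: "Q \<in> Obj C"
    and qh_assoc: "\<lbrakk> X \<in> Obj C; Y \<in> Obj C \<rbrakk> \<Longrightarrow>
          \<a> (To X) (To Y) Q \<cdot> (T2h X Y \<odot> \<one> Q) \<cdot> qh (X \<otimes> To Y)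
            \<cdot> Ta (inv_arr C (\<a> X (To Y) Q)) \<cdot> Ta (\<one> X \<odot> qh Y)
          = (\<one> (To X) \<odot> qh Y) \<cdot> T2h X (Y \<otimes> Q)"
    and qh_split_epi:
          "split_epi C (\<l> Q \<cdot> (T0 \<odot> \<one> Q) \<cdot> qh \<I> \<cdot> Ta (inv_arr C (\<l> Q)))"
    and qc_assoc: "\<lbrakk> X \<in> Obj C; Y \<in> Obj C \<rbrakk> \<Longrightarrow>
          (\<one> Q \<odot> T2c X Y) \<cdot> qc (To X \<otimes> Y) \<cdot> Ta (\<a> Q (To X) Y) \<cdot> Ta (qc X \<odot> \<one> Y)
          = \<a> Q (To X) (To Y) \<cdot> (qc X \<odot> \<one> (To Y)) \<cdot> T2c (Q \<otimes> X) Y"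
    and qc_split_epi:
          "split_epi C (\<r> Q \<cdot> (\<one> Q \<odot> T0) \<cdot> qc \<I> \<cdot> Ta (inv_arr C (\<r> Q)))"
    and T2c_qh: "\<lbrakk> X \<in> Obj C; Y \<in> Obj C \<rbrakk> \<Longrightarrow>
          \<a> (To X) (To Y) Q \<cdot> (T2c X Y \<odot> \<one> Q) \<cdot> qh (To X \<otimes> Y)
          = (\<one> (To X) \<odot> qh Y) \<cdot> T2c X (Y \<otimes> Q) \<cdot> Ta (\<a> (To X) Y Q)"
    and T2h_qc: "\<lbrakk> X \<in> Obj C; Y \<in> Obj C \<rbrakk> \<Longrightarrow>
          (\<one> Q \<odot> T2h X Y) \<cdot> qc (X \<otimes> To Y) \<cdot> Ta (\<a> Q X (To Y))
          = \<a> Q (To X) (To Y) \<cdot> (qc X \<odot> \<one> (To Y)) \<cdot> T2h (Q \<otimes> X) Y"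
    and qh_qc_counit:
          "\<l> Q \<cdot> (T0 \<odot> \<one> Q) \<cdot> qh \<I> \<cdot> Ta (inv_arr C (\<l> Q))
          = \<r> Q \<cdot> (\<one> Q \<odot> T0) \<cdot> qc \<I> \<cdot> Ta (inv_arr C (\<r> Q))"

record ('o, 'a) tmodule =
  carr :: "'o"
  act_hat :: "'o \<Rightarrow> 'a"
  act_check :: "'o \<Rightarrow> 'a"

text \<open>The two families of action morphisms are indexed by the objects of \<open>C\<close> only.  Since HOL functions are
  total, their values outside \<open>Obj C\<close> are normalized, so that modules with the same components are
  equal.\<close>

definition modules ::
  "('o, 'a, 'z) moncat_scheme \<Rightarrow> ('o \<Rightarrow> 'o) \<Rightarrow> ('a \<Rightarrow> 'a) \<Rightarrow>
   ('o \<Rightarrow> 'o \<Rightarrow> 'a) \<Rightarrow> ('o \<Rightarrow> 'o \<Rightarrow> 'a) \<Rightarrow> 'a \<Rightarrow> ('o, 'a) tmodule set" where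
  "modules C To Ta T2h T2c T0 =
    {M. multiplier_bimonad_module C To Ta T2h T2c T0 (carr M) (act_hat M) (act_check M) \<and>
        act_hat M \<in> extensional (Obj C) \<and> act_check M \<in> extensional (Obj C)}"

definition module_morphism ::
  "('o, 'a, 'z) moncat_scheme \<Rightarrow> ('o \<Rightarrow> 'o) \<Rightarrow> ('a \<Rightarrow> 'a) \<Rightarrow>
   ('o, 'a) tmodule \<Rightarrow> 'a \<Rightarrow> ('o, 'a) tmodule \<Rightarrow> bool" where
  "module_morphism C To Ta M f N \<longleftrightarrow>
    f \<in> hom C (carr M) (carr N) \<and>
    (\<forall>X \<in> Obj C.
      (\<one>\<^bsub>C\<^esub> (To X) \<odot>\<^bsub>C\<^esub> f) \<cdot>\<^bsub>C\<^esub> act_hat M X = act_hat N X \<cdot>\<^bsub>C\<^esub> Ta (\<one>\<^bsub>C\<^esub> X \<odot>\<^bsub>C\<^esub> f) \<and>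
      (f \<odot>\<^bsub>C\<^esub> \<one>\<^bsub>C\<^esub> (To X)) \<cdot>\<^bsub>C\<^esub> act_check M X = act_check N X \<cdot>\<^bsub>C\<^esub> Ta (f \<odot>\<^bsub>C\<^esub> \<one>\<^bsub>C\<^esub> X))"

text \<open>An arrow of the category of modules is a triple (source, underlying arrow of \<open>C\<close>, target),
  because one arrow of \<open>C\<close> may be a morphism between several pairs of modules.\<close>

definition module_cat ::
  "('o, 'a, 'z) moncat_scheme \<Rightarrow> ('o \<Rightarrow> 'o) \<Rightarrow> ('a \<Rightarrow> 'a) \<Rightarrow>
   ('o \<Rightarrow> 'o \<Rightarrow> 'a) \<Rightarrow> ('o \<Rightarrow> 'o \<Rightarrow> 'a) \<Rightarrow> 'a \<Rightarrow>
   (('o, 'a) tmodule, ('o, 'a) tmodule \<times> 'a \<times> ('o, 'a) tmodule) cat" where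
  "module_cat C To Ta T2h T2c T0 =
    \<lparr> Obj = modules C To Ta T2h T2c T0,
      Arr = {(M, f, N). M \<in> modules C To Ta T2h T2c T0 \<and> N \<in> modules C To Ta T2h T2c T0 \<and>
                        module_morphism C To Ta M f N},
      Dom = (\<lambda>(M, f, N). M),
      Cod = (\<lambda>(M, f, N). N),
      Idn = (\<lambda>M. (M, \<one>\<^bsub>C\<^esub> (carr M), M)),
      Comp = (\<lambda>(N', g, P) (M, f, N). (M, g \<cdot>\<^bsub>C\<^esub> f, P)) \<rparr>"

definition forget_obj :: "('o, 'a) tmodule \<Rightarrow> 'o" where
  "forget_obj M = carr M"

definition forget_arr :: "('o, 'a) tmodule \<times> 'a \<times> ('o, 'a) tmodule \<Rightarrow> 'a" where
  "forget_arr = (\<lambda>(M, f, N). f)"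

end

theory Submission
  imports Defs
begin

text \<open>
  Write \<open>\<mu>\<close> for the morphism \<open>(T\<^sub>0 \<otimes> 1) T2h : T\<^sup>2X \<rightarrow> TX\<close> and, for a module \<open>Q\<close>, write
  \<open>q : TQ \<rightarrow> Q\<close> for the common value of \<open>(T\<^sub>0 \<otimes> 1) qh\<close> and \<open>(1 \<otimes> T\<^sub>0) qc\<close>.  The product of two
  modules \<open>P\<close> and \<open>Q\<close> lives on \<open>P \<otimes> Q\<close>, with the actions

  \<open>T(X \<otimes> P \<otimes> Q) \<rightarrow> T(X \<otimes> P) \<otimes> Q \<rightarrow> TX \<otimes> P \<otimes> Q\<close>  and  \<open>T(P \<otimes> Q \<otimes> X) \<rightarrow> P \<otimes> T(Q \<otimes> X) \<rightarrow> P \<otimes> Q \<otimes> TX\<close>;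

  the unit module is \<open>\<I>\<close> with identity actions.  Up to associativity, iterating these formulas does
  not depend on the bracketing, so the constraints of \<open>C\<close> are morphisms of modules, and the forgetful
  functor is strict monoidal by construction.  All module axioms that involve only one of the two
  actions pass to \<open>P \<otimes> Q\<close> by pasting those of \<open>P\<close> and \<open>Q\<close> together (\<open>hat_tensor_module\<close>).

  The remaining axioms say that the two morphisms \<open>(p \<otimes> 1) qh\<close> and \<open>(1 \<otimes> q) pc\<close> from \<open>T(P \<otimes> Q)\<close>
  to \<open>P \<otimes> Q\<close> agree and that they are split epimorphisms.  Here the split epimorphisms of the hypotheses enter.
  The counit axiom of the bimonad shows that \<open>qh T(1 \<otimes> q) = (1 \<otimes> q) T2h\<close>
  (\<open>hat_action_counit\<close>) and hence \<open>q T(q) = q \<mu>\<close>, so that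
  \<open>(p \<otimes> 1) qh T(p \<otimes> q) = (p \<otimes> q) (\<mu> \<otimes> 1) T2h\<close> and, in the same way,
  \<open>(1 \<otimes> q) pc T(p \<otimes> q) = (p \<otimes> q) (1 \<otimes> \<mu>) T2c\<close>.  The right-hand sides are equal by
  \<open>mult_whisker_swap\<close>, and \<open>T(p \<otimes> q)\<close> is a split epimorphism, so the two morphisms agree.  The right-hand
  sides are moreover composites of split epimorphisms, hence their left factor \<open>(p \<otimes> 1) qh\<close> is
  one too.  For the unit module the morphism in question is \<open>T\<^sub>0\<close> itself.

  The axioms are symmetric under reversing the monoidal product and exchanging the roles of \<open>T2h\<close> and
  \<open>T2c\<close>.  Only statements about the action \<open>qh\<close> are therefore proved; those about \<open>qc\<close> are their
  instances for the reversed category.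
\<close>

section \<open>Calculating with arrows\<close>

context category
begin

lemma Arr_hom: "f \<in> Arr C \<Longrightarrow> f \<in> hom C (Dom C f) (Cod C f)"
  by (simp add: hom_def)

lemma Idn_Arr [simp]:
  assumes "X \<in> Obj C"
  shows "\<one> X \<in> Arr C" "Dom C (\<one> X) = X" "Cod C (\<one> X) = X"
  using Idn_in_hom[OF assms] by (simp_all add: hom_def)

lemma Comp_Arr [simp]:
  assumes "f \<in> Arr C" "g \<in> Arr C" "Cod C f = Dom C g"
  shows "g \<cdot> f \<in> Arr C" "Dom C (g \<cdot> f) = Dom C f" "Cod C (g \<cdot> f) = Cod C g"
  using Comp_in_hom[of f "Dom C f" "Cod C f" g "Cod C g"] assms by (simp_all add: hom_def)

lemma Dom_Obj [simp]: "f \<in> Arr C \<Longrightarrow> Dom C f \<in> Obj C"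
  and Cod_Obj [simp]: "f \<in> Arr C \<Longrightarrow> Cod C f \<in> Obj C"
  by (simp_all add: Dom_in_Obj Cod_in_Obj)

lemma Comp_unit [simp]:
  "f \<in> Arr C \<Longrightarrow> Dom C f = X \<Longrightarrow> f \<cdot> \<one> X = f"
  "f \<in> Arr C \<Longrightarrow> Cod C f = X \<Longrightarrow> \<one> X \<cdot> f = f"
  by (auto intro!: Comp_Idn Idn_Comp simp: hom_def)

lemma Comp_reassoc [simp]:
  assumes "f \<in> Arr C" "g \<in> Arr C" "h \<in> Arr C" "Cod C f = Dom C g" "Cod C g = Dom C h"
  shows "(h \<cdot> g) \<cdot> f = h \<cdot> g \<cdot> f"
  using Comp_assoc[of f "Dom C f" "Cod C f" g "Cod C g" h "Cod C h"] assms by (simp add: hom_def)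

text \<open>
  The simplifier keeps composites associated to the right, where a subword is a subterm only
  if it stands at the right end.  These lemmas extend an equation between words by a further arrow on
  the right, so that it can be used as a rewrite rule in the middle of a word.
\<close>

lemma extend2:
  assumes "g \<cdot> f = m" "f \<in> Arr C" "g \<in> Arr C" "x \<in> Arr C" "Cod C f = Dom C g" "Cod C x = Dom C f"
  shows "g \<cdot> f \<cdot> x = m \<cdot> x"
  using assms Comp_reassoc[of x f g] by simp

lemma extend3:
  assumes "h \<cdot> g \<cdot> f = m" "f \<in> Arr C" "g \<in> Arr C" "h \<in> Arr C" "x \<in> Arr C"
    "Cod C f = Dom C g" "Cod C g = Dom C h" "Cod C x = Dom C f"
  shows "h \<cdot> g \<cdot> f \<cdot> x = m \<cdot> x"
  using assms Comp_reassoc[of x "g \<cdot> f" h] by simp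

lemma extend4:
  assumes "k \<cdot> h \<cdot> g \<cdot> f = m" "f \<in> Arr C" "g \<in> Arr C" "h \<in> Arr C" "k \<in> Arr C" "x \<in> Arr C"
    "Cod C f = Dom C g" "Cod C g = Dom C h" "Cod C h = Dom C k" "Cod C x = Dom C f"
  shows "k \<cdot> h \<cdot> g \<cdot> f \<cdot> x = m \<cdot> x"
  using assms Comp_reassoc[of x "h \<cdot> g \<cdot> f" k] by simp

lemma inverse_arrows_unique:
  assumes "inverse_arrows C f g" "inverse_arrows C f h"
  shows "g = h"
proof -
  have f: "f \<in> Arr C" and g: "g \<in> Arr C" "Dom C g = Cod C f" "Cod C g = Dom C f" "g \<cdot> f = \<one> (Dom C f)"
    and h: "h \<in> Arr C" "Dom C h = Cod C f" "Cod C h = Dom C f" "f \<cdot> h = \<one> (Cod C f)"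
    using assms by (auto simp: inverse_arrows_def hom_def)
  have "g = g \<cdot> f \<cdot> h" using f g h by simp
  also have "\<dots> = (g \<cdot> f) \<cdot> h" by (rule Comp_reassoc[symmetric]) (use f g h in simp_all)
  finally show ?thesis using f g h(1-3) by simp
qed

lemma inv_arr_eq: "inverse_arrows C f g \<Longrightarrow> inv_arr C f = g"
  unfolding inv_arr_def using inverse_arrows_unique by (blast intro: the_equality)

lemma inverse_arrows_sym: "inverse_arrows C f g \<Longrightarrow> inverse_arrows C g f"
  by (auto simp: inverse_arrows_def hom_def)

lemma is_iso_inv:
  assumes "is_iso C f"
  shows "inverse_arrows C f (inv_arr C f)"
proof -
  obtain g where g: "inverse_arrows C f g" using assms by (auto simp: is_iso_def)
  then show ?thesis using inv_arr_eq[OF g] by simp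
qed

lemma inv_inv [simp]: "is_iso C f \<Longrightarrow> inv_arr C (inv_arr C f) = f"
  by (simp add: inv_arr_eq inverse_arrows_sym is_iso_inv)

lemma is_iso_inv_arr [simp]: "is_iso C f \<Longrightarrow> is_iso C (inv_arr C f)"
  unfolding is_iso_def[of C "inv_arr C f"] by (blast intro: inverse_arrows_sym[OF is_iso_inv])

lemma is_iso_Arr: "is_iso C f \<Longrightarrow> f \<in> Arr C"
  by (auto simp: is_iso_def inverse_arrows_def)

lemma inv_Arr [simp]:
  assumes "is_iso C f"
  shows "inv_arr C f \<in> Arr C" "Dom C (inv_arr C f) = Cod C f" "Cod C (inv_arr C f) = Dom C f"
  using is_iso_inv[OF assms] by (simp_all add: inverse_arrows_def hom_def)

lemma inv_Comp [simp]:
  assumes "is_iso C f"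
  shows "inv_arr C f \<cdot> f = \<one> (Dom C f)" "f \<cdot> inv_arr C f = \<one> (Cod C f)"
  using is_iso_inv[OF assms] by (simp_all add: inverse_arrows_def)

lemma inv_Comp_cancel [simp]:
  assumes "is_iso C f" "x \<in> Arr C"
  shows "Cod C x = Dom C f \<Longrightarrow> inv_arr C f \<cdot> f \<cdot> x = x"
    "Cod C x = Cod C f \<Longrightarrow> f \<cdot> inv_arr C f \<cdot> x = x"
  using assms by (simp_all add: extend2[OF inv_Comp(1)] extend2[OF inv_Comp(2)] is_iso_Arr)

text \<open>
  Turning a commutative square inside out along two invertible parallel sides: this yields the naturality
  of the inverse of a natural isomorphism.
\<close>

lemma inv_arr_natural:
  assumes "g \<cdot> f = f' \<cdot> h" "is_iso C g" "is_iso C h" "f \<in> Arr C" "f' \<in> Arr C"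
    "Cod C f = Dom C g" "Cod C h = Dom C f'"
  shows "inv_arr C g \<cdot> f' = f \<cdot> inv_arr C h"
proof -
  have h: "h \<in> Arr C" and g: "g \<in> Arr C" using assms is_iso_Arr by auto
  have d: "Dom C f = Dom C h" "Cod C f' = Cod C g"
    using arg_cong[OF assms(1), of "Dom C"] arg_cong[OF assms(1), of "Cod C"] assms(2-) h g
    by simp_all
  have "inv_arr C g \<cdot> f' = inv_arr C g \<cdot> (f' \<cdot> h) \<cdot> inv_arr C h"
    using assms d h g by simp
  also have "\<dots> = f \<cdot> inv_arr C h"
    unfolding assms(1)[symmetric] using assms(2-) d h g by simp
  finally show ?thesis .
qed

lemma is_isoI:
  assumes "f \<in> Arr C" "g \<in> Arr C" "Dom C g = Cod C f" "Cod C g = Dom C f"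
    "g \<cdot> f = \<one> (Dom C f)" "f \<cdot> g = \<one> (Cod C f)"
  shows "is_iso C f" "inv_arr C f = g"
proof -
  have "inverse_arrows C f g" using assms by (simp add: inverse_arrows_def hom_def)
  then show "is_iso C f" "inv_arr C f = g" by (auto simp: is_iso_def dest: inv_arr_eq)
qed

lemma iso_monic:
  assumes "is_iso C u" "u \<cdot> f = u \<cdot> g" "f \<in> Arr C" "g \<in> Arr C" "Cod C f = Dom C u" "Cod C g = Dom C u"
  shows "f = g"
proof -
  have "f = inv_arr C u \<cdot> u \<cdot> f" "g = inv_arr C u \<cdot> u \<cdot> g"
    using assms(1,3-) by simp_all
  then show ?thesis using assms(2) by simp
qed

lemma iso_epic:
  assumes "is_iso C u" "f \<cdot> u = g \<cdot> u" "f \<in> Arr C" "g \<in> Arr C" "Dom C f = Cod C u" "Dom C g = Cod C u"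
  shows "f = g"
proof -
  have "f = (f \<cdot> u) \<cdot> inv_arr C u" "g = (g \<cdot> u) \<cdot> inv_arr C u"
    using assms(1,3-) by (simp_all add: is_iso_Arr)
  then show ?thesis using assms(2) by simp
qed

lemma inv_Comp_eq_iff:
  assumes "is_iso C u" "x \<in> Arr C" "y \<in> Arr C" "Cod C x = Cod C u" "Cod C y = Dom C u"
  shows "inv_arr C u \<cdot> x = y \<longleftrightarrow> x = u \<cdot> y"
  using assms by auto

lemma Comp_inv_eq_iff:
  assumes "is_iso C u" "x \<in> Arr C" "y \<in> Arr C" "Dom C x = Dom C u" "Dom C y = Cod C u"
  shows "x \<cdot> inv_arr C u = y \<longleftrightarrow> x = y \<cdot> u"
  using assms by (auto simp: is_iso_Arr)

lemma is_iso_Comp: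
  assumes "is_iso C f" "is_iso C g" "Cod C f = Dom C g"
  shows "is_iso C (g \<cdot> f)" "inv_arr C (g \<cdot> f) = inv_arr C f \<cdot> inv_arr C g"
proof -
  have "inv_arr C f \<cdot> inv_arr C g \<cdot> g \<cdot> f = \<one> (Dom C f)"
    "g \<cdot> f \<cdot> inv_arr C f \<cdot> inv_arr C g = \<one> (Cod C g)"
    using assms by (simp_all add: is_iso_Arr)
  then show "is_iso C (g \<cdot> f)" "inv_arr C (g \<cdot> f) = inv_arr C f \<cdot> inv_arr C g"
    using is_isoI[of "g \<cdot> f" "inv_arr C f \<cdot> inv_arr C g"] assms by (simp_all add: is_iso_Arr)
qed

lemma split_epiI:
  assumes "f \<in> Arr C" "s \<in> Arr C" "Dom C s = Cod C f" "Cod C s = Dom C f" "f \<cdot> s = \<one> (Cod C f)"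
  shows "split_epi C f"
  using assms by (auto simp: split_epi_def hom_def)

lemma split_epi_section:
  assumes "split_epi C f"
  obtains s where "s \<in> Arr C" "Dom C s = Cod C f" "Cod C s = Dom C f" "f \<cdot> s = \<one> (Cod C f)"
  using assms by (auto simp: split_epi_def hom_def)

lemma split_epi_Comp:
  assumes "split_epi C f" "split_epi C g" "Cod C f = Dom C g"
  shows "split_epi C (g \<cdot> f)"
proof -
  obtain s where s: "s \<in> Arr C" "Dom C s = Cod C f" "Cod C s = Dom C f" "f \<cdot> s = \<one> (Cod C f)"
    using assms(1) by (rule split_epi_section)
  obtain t where t: "t \<in> Arr C" "Dom C t = Cod C g" "Cod C t = Dom C g" "g \<cdot> t = \<one> (Cod C g)"
    using assms(2) by (rule split_epi_section)
  have fg: "f \<in> Arr C" "g \<in> Arr C" using assms by (auto simp: split_epi_def)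
  have "(g \<cdot> f) \<cdot> (s \<cdot> t) = \<one> (Cod C g)"
    using fg s t assms(3) by (simp add: extend2[OF s(4)])
  then show ?thesis
    using fg s t assms(3) by (intro split_epiI[of _ "s \<cdot> t"]) simp_all
qed

lemma split_epi_cancel:
  assumes "split_epi C (g \<cdot> f)" "f \<in> Arr C" "g \<in> Arr C" "Cod C f = Dom C g"
  shows "split_epi C g"
proof -
  obtain s where "s \<in> Arr C" "Dom C s = Cod C (g \<cdot> f)" "Cod C s = Dom C (g \<cdot> f)"
      "(g \<cdot> f) \<cdot> s = \<one> (Cod C (g \<cdot> f))"
    using assms(1) by (rule split_epi_section)
  then show ?thesis
    using assms(2-) by (intro split_epiI[of _ "f \<cdot> s"]) simp_all
qed

lemma split_epi_epic:
  assumes "split_epi C u" "f \<cdot> u = g \<cdot> u" "f \<in> Arr C" "g \<in> Arr C" "Dom C f = Cod C u" "Dom C g = Cod C u"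
  shows "f = g"
proof -
  obtain s where s: "s \<in> Arr C" "Dom C s = Cod C u" "Cod C s = Dom C u" "u \<cdot> s = \<one> (Cod C u)"
    using assms(1) by (rule split_epi_section)
  have u: "u \<in> Arr C" using assms by (auto simp: split_epi_def)
  have "f = (f \<cdot> u) \<cdot> s" "g = (g \<cdot> u) \<cdot> s"
    using s u assms(3-) by simp_all
  then show ?thesis using assms(2) by simp
qed

end

lemma (in cat_functor) map_Arr [simp]:
  assumes "f \<in> Arr C"
  shows "Fa f \<in> Arr D" "Dom D (Fa f) = Fo (Dom C f)" "Cod D (Fa f) = Fo (Cod C f)"
  using map_hom[OF dom.Arr_hom[OF assms]] by (simp_all add: hom_def)

lemma (in cat_functor) map_Comp' [simp]:
  assumes "f \<in> Arr C" "g \<in> Arr C" "Cod C f = Dom C g"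
  shows "Fa (g \<cdot>\<^bsub>C\<^esub> f) = Fa g \<cdot>\<^bsub>D\<^esub> Fa f"
  using map_Comp[of f "Dom C f" "Cod C f" g "Cod C g"] assms by (simp add: hom_def)

lemma (in cat_functor) map_iso:
  assumes "is_iso C f"
  shows "is_iso D (Fa f)" "inv_arr D (Fa f) = Fa (inv_arr C f)"
proof -
  have f: "f \<in> Arr C" using assms dom.is_iso_Arr by simp
  have "Fa (inv_arr C f) \<cdot>\<^bsub>D\<^esub> Fa f = \<one>\<^bsub>D\<^esub> (Fo (Dom C f))"
    "Fa f \<cdot>\<^bsub>D\<^esub> Fa (inv_arr C f) = \<one>\<^bsub>D\<^esub> (Fo (Cod C f))"
    using assms f map_Comp'[of f "inv_arr C f"] map_Comp'[of "inv_arr C f" f]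
    by (simp_all add: map_Idn del: map_Comp')
  then show "is_iso D (Fa f)" "inv_arr D (Fa f) = Fa (inv_arr C f)"
    using assms f by (auto intro!: cod.is_isoI)
qed

lemma (in cat_functor) map_split_epi:
  assumes "split_epi C f"
  shows "split_epi D (Fa f)"
proof -
  obtain s where s: "s \<in> Arr C" "Dom C s = Cod C f" "Cod C s = Dom C f" "f \<cdot>\<^bsub>C\<^esub> s = \<one>\<^bsub>C\<^esub> (Cod C f)"
    using assms by (rule dom.split_epi_section)
  have f: "f \<in> Arr C" using assms by (auto simp: split_epi_def)
  have "Fa f \<cdot>\<^bsub>D\<^esub> Fa s = \<one>\<^bsub>D\<^esub> (Fo (Cod C f))"
    using s f map_Comp'[of s f] by (simp add: map_Idn)
  then show ?thesis using s f by (intro cod.split_epiI[of _ "Fa s"]) simp_all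
qed

lemma prod_cat_simps [simp]:
  "Obj (C \<times>\<^sub>c D) = Obj C \<times> Obj D"
  "Arr (C \<times>\<^sub>c D) = Arr C \<times> Arr D"
  "Dom (C \<times>\<^sub>c D) (f, g) = (Dom C f, Dom D g)"
  "Cod (C \<times>\<^sub>c D) (f, g) = (Cod C f, Cod D g)"
  "\<one>\<^bsub>C \<times>\<^sub>c D\<^esub> (X, Y) = (\<one>\<^bsub>C\<^esub> X, \<one>\<^bsub>D\<^esub> Y)"
  "(f', g') \<cdot>\<^bsub>C \<times>\<^sub>c D\<^esub> (f, g) = (f' \<cdot>\<^bsub>C\<^esub> f, g' \<cdot>\<^bsub>D\<^esub> g)"
  by (simp_all add: prod_cat_def)

lemma (in natural_transformation) natural_Arr:
  assumes "X \<in> Obj C"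
  shows "t X \<in> Arr D" "Dom D (t X) = Fo X" "Cod D (t X) = Go X"
  using component_in_hom[OF assms] by (simp_all add: hom_def)

lemma (in natural_transformation) naturality':
  "f \<in> Arr C \<Longrightarrow> t (Cod C f) \<cdot>\<^bsub>D\<^esub> Fa f = Ga f \<cdot>\<^bsub>D\<^esub> t (Dom C f)"
  using naturality F.dom.Arr_hom by blast

section \<open>Monoidal categories\<close>

context monoidal_category
begin

lemma UnitO_Obj [simp]: "\<I> \<in> Obj C"
  by (rule UnitO_in_Obj)

lemma TensO_Obj [simp]: "X \<in> Obj C \<Longrightarrow> Y \<in> Obj C \<Longrightarrow> X \<otimes> Y \<in> Obj C"
  using cat_functor.map_Obj[OF tensor_functor, of "(X, Y)"] by simp

lemma TensA_Arr [simp]: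
  assumes "f \<in> Arr C" "g \<in> Arr C"
  shows "f \<odot> g \<in> Arr C" "Dom C (f \<odot> g) = Dom C f \<otimes> Dom C g" "Cod C (f \<odot> g) = Cod C f \<otimes> Cod C g"
  using cat_functor.map_Arr[OF tensor_functor, of "(f, g)"] assms by simp_all

lemma TensA_Idn [simp]: "X \<in> Obj C \<Longrightarrow> Y \<in> Obj C \<Longrightarrow> \<one> X \<odot> \<one> Y = \<one> (X \<otimes> Y)"
  using cat_functor.map_Idn[OF tensor_functor, of "(X, Y)"] by simp

lemma interchange:
  assumes "f \<in> Arr C" "g \<in> Arr C" "h \<in> Arr C" "k \<in> Arr C" "Cod C h = Dom C f" "Cod C k = Dom C g"
  shows "(f \<odot> g) \<cdot> (h \<odot> k) = (f \<cdot> h) \<odot> (g \<cdot> k)"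
  using cat_functor.map_Comp'[OF tensor_functor, of "(h, k)" "(f, g)"] assms by simp

lemma whisker_Comp [simp]:
  assumes "f \<in> Arr C" "g \<in> Arr C" "Cod C f = Dom C g" "X \<in> Obj C"
  shows "(g \<cdot> f) \<odot> \<one> X = (g \<odot> \<one> X) \<cdot> (f \<odot> \<one> X)"
    "\<one> X \<odot> (g \<cdot> f) = (\<one> X \<odot> g) \<cdot> (\<one> X \<odot> f)"
  using assms by (simp_all add: interchange)

lemma whisker_commute:
  assumes "f \<in> Arr C" "g \<in> Arr C" "X = Cod C f" "Y = Dom C g" "X' = Dom C f" "Y' = Cod C g"
  shows "(f \<odot> \<one> Y') \<cdot> (\<one> X' \<odot> g) = (\<one> X \<odot> g) \<cdot> (f \<odot> \<one> Y)"
  using assms by (simp add: interchange)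

lemma TensA_split:
  assumes "f \<in> Arr C" "g \<in> Arr C"
  shows "f \<odot> g = (f \<odot> \<one> (Cod C g)) \<cdot> (\<one> (Dom C f) \<odot> g)"
  using assms by (simp add: interchange)

lemma TensA_iso:
  assumes "is_iso C f" "is_iso C g"
  shows "is_iso C (f \<odot> g)" "inv_arr C (f \<odot> g) = inv_arr C f \<odot> inv_arr C g"
  using is_isoI[of "f \<odot> g" "inv_arr C f \<odot> inv_arr C g"] assms
  by (simp_all add: is_iso_Arr interchange)

lemma Idn_iso: "X \<in> Obj C \<Longrightarrow> is_iso C (\<one> X)" "X \<in> Obj C \<Longrightarrow> inv_arr C (\<one> X) = \<one> X"
  using is_isoI[of "\<one> X" "\<one> X"] by simp_all

lemma whisker_iso [simp]:
  assumes "is_iso C f" "X \<in> Obj C"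
  shows "is_iso C (f \<odot> \<one> X)" "inv_arr C (f \<odot> \<one> X) = inv_arr C f \<odot> \<one> X"
    "is_iso C (\<one> X \<odot> f)" "inv_arr C (\<one> X \<odot> f) = \<one> X \<odot> inv_arr C f"
  using assms by (simp_all add: TensA_iso Idn_iso)

lemma whisker_inv_Comp [simp]:
  assumes "is_iso C f" "X \<in> Obj C"
  shows "(inv_arr C f \<odot> \<one> X) \<cdot> (f \<odot> \<one> X) = \<one> (Dom C f \<otimes> X)"
    "(f \<odot> \<one> X) \<cdot> (inv_arr C f \<odot> \<one> X) = \<one> (Cod C f \<otimes> X)"
    "(\<one> X \<odot> inv_arr C f) \<cdot> (\<one> X \<odot> f) = \<one> (X \<otimes> Dom C f)"
    "(\<one> X \<odot> f) \<cdot> (\<one> X \<odot> inv_arr C f) = \<one> (X \<otimes> Cod C f)"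
  using assms by (simp_all add: interchange is_iso_Arr)

lemma whisker_inv_Comp_cancel [simp]:
  assumes "is_iso C f" "X \<in> Obj C" "x \<in> Arr C"
  shows "Cod C x = Dom C f \<otimes> X \<Longrightarrow> (inv_arr C f \<odot> \<one> X) \<cdot> (f \<odot> \<one> X) \<cdot> x = x"
    "Cod C x = Cod C f \<otimes> X \<Longrightarrow> (f \<odot> \<one> X) \<cdot> (inv_arr C f \<odot> \<one> X) \<cdot> x = x"
    "Cod C x = X \<otimes> Dom C f \<Longrightarrow> (\<one> X \<odot> inv_arr C f) \<cdot> (\<one> X \<odot> f) \<cdot> x = x"
    "Cod C x = X \<otimes> Cod C f \<Longrightarrow> (\<one> X \<odot> f) \<cdot> (\<one> X \<odot> inv_arr C f) \<cdot> x = x"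
  using assms by (simp_all add: whisker_inv_Comp[THEN extend2] is_iso_Arr)

lemma split_epi_TensA: "split_epi C f \<Longrightarrow> split_epi C g \<Longrightarrow> split_epi C (f \<odot> g)"
proof -
  assume f: "split_epi C f" and g: "split_epi C g"
  obtain s where s: "s \<in> Arr C" "Dom C s = Cod C f" "Cod C s = Dom C f" "f \<cdot> s = \<one> (Cod C f)"
    using f by (rule split_epi_section)
  obtain t where t: "t \<in> Arr C" "Dom C t = Cod C g" "Cod C t = Dom C g" "g \<cdot> t = \<one> (Cod C g)"
    using g by (rule split_epi_section)
  have "f \<in> Arr C" "g \<in> Arr C" using f g by (auto simp: split_epi_def)
  then show ?thesis
    using s t by (intro split_epiI[of _ "s \<odot> t"]) (simp_all add: interchange)
qed

lemma Assoc_Arr [simp]: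
  assumes "X \<in> Obj C" "Y \<in> Obj C" "Z \<in> Obj C"
  shows "\<a> X Y Z \<in> Arr C" "Dom C (\<a> X Y Z) = (X \<otimes> Y) \<otimes> Z" "Cod C (\<a> X Y Z) = X \<otimes> Y \<otimes> Z"
    "is_iso C (\<a> X Y Z)"
  using natural_transformation.natural_Arr[OF natural_isomorphism.axioms(1)[OF Assoc_natural_iso],
        of "(X, Y, Z)"]
    natural_isomorphism.component_iso[OF Assoc_natural_iso, of "(X, Y, Z)"] assms
  by simp_all

lemma Assoc_natural:
  assumes "f \<in> Arr C" "g \<in> Arr C" "h \<in> Arr C" "X = Dom C f" "Y = Dom C g" "Z = Dom C h"
    "X' = Cod C f" "Y' = Cod C g" "Z' = Cod C h"
  shows "\<a> X' Y' Z' \<cdot> ((f \<odot> g) \<odot> h) = (f \<odot> g \<odot> h) \<cdot> \<a> X Y Z"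
  using natural_transformation.naturality'[OF natural_isomorphism.axioms(1)[OF Assoc_natural_iso],
      of "(f, g, h)"] assms
  by simp

lemma Lunit_Arr [simp]:
  assumes "X \<in> Obj C"
  shows "\<l> X \<in> Arr C" "Dom C (\<l> X) = \<I> \<otimes> X" "Cod C (\<l> X) = X" "is_iso C (\<l> X)"
  using natural_transformation.natural_Arr[OF natural_isomorphism.axioms(1)[OF Lunit_natural_iso],
        of X]
    natural_isomorphism.component_iso[OF Lunit_natural_iso, of X] assms
  by simp_all

lemma Lunit_natural: "f \<in> Arr C \<Longrightarrow> \<l> (Cod C f) \<cdot> (\<one> \<I> \<odot> f) = f \<cdot> \<l> (Dom C f)"
  using natural_transformation.naturality'[OF natural_isomorphism.axioms(1)[OF Lunit_natural_iso]]
  by simp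

lemma Runit_Arr [simp]:
  assumes "X \<in> Obj C"
  shows "\<r> X \<in> Arr C" "Dom C (\<r> X) = X \<otimes> \<I>" "Cod C (\<r> X) = X" "is_iso C (\<r> X)"
  using natural_transformation.natural_Arr[OF natural_isomorphism.axioms(1)[OF Runit_natural_iso],
        of X]
    natural_isomorphism.component_iso[OF Runit_natural_iso, of X] assms
  by simp_all

lemma Runit_natural: "f \<in> Arr C \<Longrightarrow> \<r> (Cod C f) \<cdot> (f \<odot> \<one> \<I>) = f \<cdot> \<r> (Dom C f)"
  using natural_transformation.naturality'[OF natural_isomorphism.axioms(1)[OF Runit_natural_iso]]
  by simp

abbreviation inv_Assoc ("\<a>\<^sup>-") where "\<a>\<^sup>- X Y Z \<equiv> inv_arr C (\<a> X Y Z)"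

lemma pentagon':
  assumes "W \<in> Obj C" "X \<in> Obj C" "Y \<in> Obj C" "Z \<in> Obj C"
  shows "\<a>\<^sup>- (W \<otimes> X) Y Z \<cdot> \<a>\<^sup>- W X (Y \<otimes> Z)
    = (\<a>\<^sup>- W X Y \<odot> \<one> Z) \<cdot> \<a>\<^sup>- W (X \<otimes> Y) Z \<cdot> (\<one> W \<odot> \<a>\<^sup>- X Y Z)"
  using arg_cong[OF pentagon[OF assms], of "inv_arr C"] assms by (simp add: is_iso_Comp)

lemma triangle':
  assumes "X \<in> Obj C" "Y \<in> Obj C"
  shows "(\<r> X \<odot> \<one> Y) \<cdot> \<a>\<^sup>- X \<I> Y = \<one> X \<odot> \<l> Y"
  using assms by (simp flip: triangle)

lemma Assoc_inv_natural:
  assumes "f \<in> Arr C" "g \<in> Arr C" "h \<in> Arr C" "X = Dom C f" "Y = Dom C g" "Z = Dom C h"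
    "X' = Cod C f" "Y' = Cod C g" "Z' = Cod C h"
  shows "\<a>\<^sup>- X' Y' Z' \<cdot> (f \<odot> g \<odot> h) = ((f \<odot> g) \<odot> h) \<cdot> \<a>\<^sup>- X Y Z"
  by (rule inv_arr_natural[OF Assoc_natural]) (use assms in simp_all)

text \<open>
  Naturality of the associator in one variable at a time, oriented so that rewriting moves associators
  to the left.
\<close>

lemma Assoc_whisker:
  assumes "f \<in> Arr C" "Dom C f = X" "Y \<in> Obj C" "Z \<in> Obj C"
  shows "(f \<odot> \<one> (Y \<otimes> Z)) \<cdot> \<a> X Y Z = \<a> (Cod C f) Y Z \<cdot> ((f \<odot> \<one> Y) \<odot> \<one> Z)"
    "(\<one> Y \<odot> f \<odot> \<one> Z) \<cdot> \<a> Y X Z = \<a> Y (Cod C f) Z \<cdot> ((\<one> Y \<odot> f) \<odot> \<one> Z)"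
    "(\<one> Y \<odot> \<one> Z \<odot> f) \<cdot> \<a> Y Z X = \<a> Y Z (Cod C f) \<cdot> (\<one> (Y \<otimes> Z) \<odot> f)"
  using Assoc_natural[of f "\<one> Y" "\<one> Z"] Assoc_natural[of "\<one> Y" f "\<one> Z"]
    Assoc_natural[of "\<one> Y" "\<one> Z" f] assms
  by simp_all

text \<open>
  The inverse associators stand at the right end of the words below, and these rules move them further
  to the right.
\<close>

lemma Assoc_inv_whisker:
  assumes "f \<in> Arr C" "Cod C f = X" "Y \<in> Obj C" "Z \<in> Obj C"
  shows "\<a>\<^sup>- X Y Z \<cdot> (f \<odot> \<one> (Y \<otimes> Z)) = ((f \<odot> \<one> Y) \<odot> \<one> Z) \<cdot> \<a>\<^sup>- (Dom C f) Y Z"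
    "\<a>\<^sup>- Y X Z \<cdot> (\<one> Y \<odot> f \<odot> \<one> Z) = ((\<one> Y \<odot> f) \<odot> \<one> Z) \<cdot> \<a>\<^sup>- Y (Dom C f) Z"
    "\<a>\<^sup>- Y Z X \<cdot> (\<one> Y \<odot> \<one> Z \<odot> f) = (\<one> (Y \<otimes> Z) \<odot> f) \<cdot> \<a>\<^sup>- Y Z (Dom C f)"
  using Assoc_inv_natural[of f "\<one> Y" "\<one> Z"] Assoc_inv_natural[of "\<one> Y" f "\<one> Z"]
    Assoc_inv_natural[of "\<one> Y" "\<one> Z" f] assms
  by simp_all

lemma Lunit_inv_natural:
  "f \<in> Arr C \<Longrightarrow> inv_arr C (\<l> (Cod C f)) \<cdot> f = (\<one> \<I> \<odot> f) \<cdot> inv_arr C (\<l> (Dom C f))"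
  by (rule inv_arr_natural[OF Lunit_natural]) simp_all

lemma Runit_inv_natural:
  "f \<in> Arr C \<Longrightarrow> inv_arr C (\<r> (Cod C f)) \<cdot> f = (f \<odot> \<one> \<I>) \<cdot> inv_arr C (\<r> (Dom C f))"
  by (rule inv_arr_natural[OF Runit_natural]) simp_all

text \<open>
  The unit constraints identify the functors \<open>\<I> \<otimes> -\<close> and \<open>- \<otimes> \<I>\<close> with the identity functor, so both
  functors are faithful.
\<close>

lemma whisker_UnitO_faithful:
  assumes "f \<in> Arr C" "g \<in> Arr C" "Dom C f = Dom C g" "Cod C f = Cod C g"
  shows "\<one> \<I> \<odot> f = \<one> \<I> \<odot> g \<Longrightarrow> f = g" "f \<odot> \<one> \<I> = g \<odot> \<one> \<I> \<Longrightarrow> f = g"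
proof -
  assume "\<one> \<I> \<odot> f = \<one> \<I> \<odot> g"
  then show "f = g"
    using Lunit_natural[of f] Lunit_natural[of g] assms
    by (intro iso_epic[of "\<l> (Dom C f)" f g]) simp_all
next
  assume "f \<odot> \<one> \<I> = g \<odot> \<one> \<I>"
  then show "f = g"
    using Runit_natural[of f] Runit_natural[of g] assms
    by (intro iso_epic[of "\<r> (Dom C f)" f g]) simp_all
qed

text \<open>
  Kelly's argument that this follows from the pentagon and triangle axioms.  By faithfulness of \<open>\<I> \<otimes> -\<close>
  it suffices to compare the two sides after tensoring with \<open>\<I>\<close>, and the pentagon with two unit
  entries does so after composing with an isomorphism.
\<close>

lemma Lunit_TensO:
  assumes "X \<in> Obj C" "Y \<in> Obj C"
  shows "\<l> (X \<otimes> Y) \<cdot> \<a> \<I> X Y = \<l> X \<odot> \<one> Y"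
proof -
  note [simp] = assms
  let ?u = "\<a> \<I> (\<I> \<otimes> X) Y \<cdot> (\<a> \<I> \<I> X \<odot> \<one> Y)"
  have "(\<one> \<I> \<odot> (\<l> (X \<otimes> Y) \<cdot> \<a> \<I> X Y)) \<cdot> ?u
      = (\<one> \<I> \<odot> \<l> (X \<otimes> Y)) \<cdot> \<a> \<I> \<I> (X \<otimes> Y) \<cdot> \<a> (\<I> \<otimes> \<I>) X Y"
    by (simp add: pentagon)
  also have "\<dots> = (\<r> \<I> \<odot> \<one> X \<odot> \<one> Y) \<cdot> \<a> (\<I> \<otimes> \<I>) X Y"
    by (simp add: triangle[THEN extend2])
  also have "\<dots> = \<a> \<I> X Y \<cdot> ((\<r> \<I> \<odot> \<one> X) \<odot> \<one> Y)"
    by (rule Assoc_natural[symmetric]) simp_all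
  also have "\<dots> = \<a> \<I> X Y \<cdot> ((\<one> \<I> \<odot> \<l> X) \<odot> \<one> Y) \<cdot> (\<a> \<I> \<I> X \<odot> \<one> Y)"
    by (simp add: triangle[symmetric])
  also have "\<dots> = (\<one> \<I> \<odot> (\<l> X \<odot> \<one> Y)) \<cdot> ?u"
    by (simp add: Assoc_natural[of "\<one> \<I>" "\<l> X" "\<one> Y", THEN extend2])
  finally have "\<one> \<I> \<odot> (\<l> (X \<otimes> Y) \<cdot> \<a> \<I> X Y) = \<one> \<I> \<odot> (\<l> X \<odot> \<one> Y)"
    by (rule iso_epic[rotated]) (simp_all add: is_iso_Comp)
  then show ?thesis
    by (rule whisker_UnitO_faithful(1)[rotated -1]) simp_all
qed

text \<open>
  By naturality \<open>\<l> (\<I> \<otimes> \<I>) = \<one> \<I> \<odot> \<l> \<I>\<close>.  Substituted in the previous lemma and compared with the triangle, this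
  gives \<open>\<l> \<I> \<odot> \<one> \<I> = \<r> \<I> \<odot> \<one> \<I>\<close>.
\<close>

lemma Lunit_UnitO: "\<l> \<I> = \<r> \<I>"
proof -
  have "\<l> \<I> \<cdot> \<l> (\<I> \<otimes> \<I>) = \<l> \<I> \<cdot> (\<one> \<I> \<odot> \<l> \<I>)"
    using Lunit_natural[of "\<l> \<I>"] by simp
  then have "\<l> (\<I> \<otimes> \<I>) = \<one> \<I> \<odot> \<l> \<I>"
    by (rule iso_monic[rotated]) simp_all
  then have "\<l> \<I> \<odot> \<one> \<I> = \<r> \<I> \<odot> \<one> \<I>"
    using Lunit_TensO[of \<I> \<I>] triangle[of \<I> \<I>] by simp
  then show ?thesis
    by (rule whisker_UnitO_faithful(2)[rotated -1]) simp_all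
qed

end

lemma cat_functorI:
  assumes "category C" "category D" "\<And>X. X \<in> Obj C \<Longrightarrow> Fo X \<in> Obj D"
    and "\<And>f. f \<in> Arr C \<Longrightarrow>
      Fa f \<in> Arr D \<and> Dom D (Fa f) = Fo (Dom C f) \<and> Cod D (Fa f) = Fo (Cod C f)"
    and "\<And>X. X \<in> Obj C \<Longrightarrow> Fa (\<one>\<^bsub>C\<^esub> X) = \<one>\<^bsub>D\<^esub> (Fo X)"
    and "\<And>f g. f \<in> Arr C \<Longrightarrow> g \<in> Arr C \<Longrightarrow> Cod C f = Dom C g \<Longrightarrow>
      Fa (g \<cdot>\<^bsub>C\<^esub> f) = Fa g \<cdot>\<^bsub>D\<^esub> Fa f"
  shows "cat_functor C D Fo Fa"
  using assms by (auto simp: cat_functor_def cat_functor_axioms_def hom_def)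

lemma natural_transformationI:
  assumes "cat_functor C D Fo Fa" "cat_functor C D Go Ga"
    and "\<And>X. X \<in> Obj C \<Longrightarrow> t X \<in> Arr D \<and> Dom D (t X) = Fo X \<and> Cod D (t X) = Go X"
    and "\<And>f. f \<in> Arr C \<Longrightarrow> t (Cod C f) \<cdot>\<^bsub>D\<^esub> Fa f = Ga f \<cdot>\<^bsub>D\<^esub> t (Dom C f)"
  shows "natural_transformation C D Fo Fa Go Ga t"
  using assms by (auto simp: natural_transformation_def natural_transformation_axioms_def hom_def)

lemma category_prod:
  assumes "category C" "category D"
  shows "category (C \<times>\<^sub>c D)"
proof -
  interpret C: category C by fact
  interpret D: category D by fact
  show ?thesis by (standard; auto simp: hom_def)
qed

text \<open>
  The axioms of a monoidal category without product categories.  Both the reversed category and the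
  category of modules are recognized as monoidal in this form.
\<close>

lemma monoidal_categoryI:
  fixes C :: "('o, 'a, 'z) moncat_scheme" (structure)
  assumes cat: "category C"
    and TensO: "\<And>X Y. X \<in> Obj C \<Longrightarrow> Y \<in> Obj C \<Longrightarrow> X \<otimes> Y \<in> Obj C"
    and TensA: "\<And>f g. f \<in> Arr C \<Longrightarrow> g \<in> Arr C \<Longrightarrow> f \<odot> g \<in> Arr C \<and>
      Dom C (f \<odot> g) = Dom C f \<otimes> Dom C g \<and> Cod C (f \<odot> g) = Cod C f \<otimes> Cod C g"
    and Idn: "\<And>X Y. X \<in> Obj C \<Longrightarrow> Y \<in> Obj C \<Longrightarrow> \<one> X \<odot> \<one> Y = \<one> (X \<otimes> Y)"
    and interchange: "\<And>f g h k. \<lbrakk> f \<in> Arr C; g \<in> Arr C; h \<in> Arr C; k \<in> Arr C;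
      Cod C h = Dom C f; Cod C k = Dom C g \<rbrakk> \<Longrightarrow> (f \<cdot> h) \<odot> (g \<cdot> k) = (f \<odot> g) \<cdot> (h \<odot> k)"
    and UnitO: "\<I> \<in> Obj C"
    and Assoc: "\<And>X Y Z. X \<in> Obj C \<Longrightarrow> Y \<in> Obj C \<Longrightarrow> Z \<in> Obj C \<Longrightarrow>
      \<a> X Y Z \<in> Arr C \<and> Dom C (\<a> X Y Z) = (X \<otimes> Y) \<otimes> Z \<and> Cod C (\<a> X Y Z) = X \<otimes> Y \<otimes> Z \<and>
      is_iso C (\<a> X Y Z)"
    and Assoc_natural: "\<And>f g h. f \<in> Arr C \<Longrightarrow> g \<in> Arr C \<Longrightarrow> h \<in> Arr C \<Longrightarrow>
      \<a> (Cod C f) (Cod C g) (Cod C h) \<cdot> ((f \<odot> g) \<odot> h)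
      = (f \<odot> g \<odot> h) \<cdot> \<a> (Dom C f) (Dom C g) (Dom C h)"
    and Lunit: "\<And>X. X \<in> Obj C \<Longrightarrow>
      \<l> X \<in> Arr C \<and> Dom C (\<l> X) = \<I> \<otimes> X \<and> Cod C (\<l> X) = X \<and> is_iso C (\<l> X)"
    and Lunit_natural: "\<And>f. f \<in> Arr C \<Longrightarrow> \<l> (Cod C f) \<cdot> (\<one> \<I> \<odot> f) = f \<cdot> \<l> (Dom C f)"
    and Runit: "\<And>X. X \<in> Obj C \<Longrightarrow>
      \<r> X \<in> Arr C \<and> Dom C (\<r> X) = X \<otimes> \<I> \<and> Cod C (\<r> X) = X \<and> is_iso C (\<r> X)"
    and Runit_natural: "\<And>f. f \<in> Arr C \<Longrightarrow> \<r> (Cod C f) \<cdot> (f \<odot> \<one> \<I>) = f \<cdot> \<r> (Dom C f)"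
    and pentagon: "\<And>W X Y Z. \<lbrakk> W \<in> Obj C; X \<in> Obj C; Y \<in> Obj C; Z \<in> Obj C \<rbrakk> \<Longrightarrow>
      (\<one> W \<odot> \<a> X Y Z) \<cdot> \<a> W (X \<otimes> Y) Z \<cdot> (\<a> W X Y \<odot> \<one> Z)
      = \<a> W X (Y \<otimes> Z) \<cdot> \<a> (W \<otimes> X) Y Z"
    and triangle: "\<And>X Y. X \<in> Obj C \<Longrightarrow> Y \<in> Obj C \<Longrightarrow> (\<one> X \<odot> \<l> Y) \<cdot> \<a> X \<I> Y = \<r> X \<odot> \<one> Y"
  shows "monoidal_category C"
proof -
  interpret category C by fact
  note [simp] = TensO TensA Idn interchange UnitO
  note prod = category_prod[OF cat cat] category_prod[OF cat category_prod[OF cat cat]]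
  have two: "cat_functor (C \<times>\<^sub>c C) C (\<lambda>(X, Y). X \<otimes> Y) (\<lambda>(f, g). f \<odot> g)"
    by (rule cat_functorI) (use cat prod in auto)
  have three: "cat_functor (C \<times>\<^sub>c C \<times>\<^sub>c C) C
      (\<lambda>(X, Y, Z). (X \<otimes> Y) \<otimes> Z) (\<lambda>(f, g, h). (f \<odot> g) \<odot> h)"
    "cat_functor (C \<times>\<^sub>c C \<times>\<^sub>c C) C
      (\<lambda>(X, Y, Z). X \<otimes> Y \<otimes> Z) (\<lambda>(f, g, h). f \<odot> g \<odot> h)"
    by (rule cat_functorI; use cat prod in auto)+
  have one: "cat_functor C C (\<lambda>X. \<I> \<otimes> X) (\<lambda>f. \<one> \<I> \<odot> f)"
    "cat_functor C C (\<lambda>X. X \<otimes> \<I>) (\<lambda>f. f \<odot> \<one> \<I>)" "cat_functor C C (\<lambda>X. X) (\<lambda>f. f)"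
    subgoal
      by (rule cat_functorI) (use cat interchange[of "\<one> \<I>" _ "\<one> \<I>"] in \<open>auto simp del: interchange\<close>)
    subgoal
      by (rule cat_functorI) (use cat interchange[of _ "\<one> \<I>" _ "\<one> \<I>"] in \<open>auto simp del: interchange\<close>)
    subgoal by (rule cat_functorI) (use cat in auto)
    done
  show ?thesis
    unfolding monoidal_category_def monoidal_category_axioms_def natural_isomorphism_def
      natural_isomorphism_axioms_def natural_transformation_def natural_transformation_axioms_def
    using cat two three one Assoc Assoc_natural Lunit Lunit_natural Runit Runit_natural
      pentagon triangle UnitO
    by (auto simp: hom_def simp del: interchange)
qed

section \<open>Reversing the monoidal product\<close>

text \<open>
  The associator has to run from \<open>Z \<otimes> (Y \<otimes> X)\<close> to \<open>(Z \<otimes> Y) \<otimes> X\<close>, hence the inverse.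
\<close>

definition rev_cat :: "('o, 'a, 'z) moncat_scheme \<Rightarrow> ('o, 'a) moncat" where
  "rev_cat C =
    \<lparr> Obj = Obj C, Arr = Arr C, Dom = Dom C, Cod = Cod C, Idn = Idn C, Comp = Comp C,
      TensO = (\<lambda>X Y. Y \<otimes>\<^bsub>C\<^esub> X), TensA = (\<lambda>f g. g \<odot>\<^bsub>C\<^esub> f), UnitO = \<I>\<^bsub>C\<^esub>,
      Assoc = (\<lambda>X Y Z. inv_arr C (\<a>\<^bsub>C\<^esub> Z Y X)), Lunit = Runit C, Runit = Lunit C \<rparr>"

lemma rev_cat_simps [simp]:
  "Obj (rev_cat C) = Obj C" "Arr (rev_cat C) = Arr C" "Dom (rev_cat C) = Dom C"
  "Cod (rev_cat C) = Cod C" "Idn (rev_cat C) = Idn C" "Comp (rev_cat C) = Comp C"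
  "X \<otimes>\<^bsub>rev_cat C\<^esub> Y = Y \<otimes>\<^bsub>C\<^esub> X" "f \<odot>\<^bsub>rev_cat C\<^esub> g = g \<odot>\<^bsub>C\<^esub> f" "\<I>\<^bsub>rev_cat C\<^esub> = \<I>\<^bsub>C\<^esub>"
  "\<a>\<^bsub>rev_cat C\<^esub> X Y Z = inv_arr C (\<a>\<^bsub>C\<^esub> Z Y X)" "\<l>\<^bsub>rev_cat C\<^esub> = \<r>\<^bsub>C\<^esub>" "\<r>\<^bsub>rev_cat C\<^esub> = \<l>\<^bsub>C\<^esub>"
  "hom (rev_cat C) = hom C" "inverse_arrows (rev_cat C) = inverse_arrows C"
  "inv_arr (rev_cat C) = inv_arr C" "is_iso (rev_cat C) = is_iso C"
  "split_epi (rev_cat C) = split_epi C"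
proof -
  show "hom (rev_cat C) = hom C"
    by (intro ext) (simp add: hom_def rev_cat_def)
  then show "inverse_arrows (rev_cat C) = inverse_arrows C" "split_epi (rev_cat C) = split_epi C"
    by (intro ext; simp add: inverse_arrows_def split_epi_def rev_cat_def)+
  then show "inv_arr (rev_cat C) = inv_arr C" "is_iso (rev_cat C) = is_iso C"
    by (intro ext; simp add: inv_arr_def is_iso_def)+
qed (simp_all add: rev_cat_def)

lemma (in monoidal_category) category_rev: "category (rev_cat C)"
  by standard (auto simp: hom_def)

lemma (in monoidal_category) monoidal_category_rev: "monoidal_category (rev_cat C)"
proof (rule monoidal_categoryI, goal_cases)
  case (5 f g h k) then show ?case by (simp add: interchange)
next
  case (8 f g h) then show ?case by (simp add: Assoc_inv_natural)
next
  case (13 W X Y Z) then show ?case using pentagon'[of Z Y X W] by simp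
next
  case (14 X Y)
  then show ?case using triangle[of Y X, symmetric] by simp
qed (simp_all add: category_rev Runit_natural Lunit_natural)

lemma (in monoidal_category) Runit_TensO:
  assumes "X \<in> Obj C" "Y \<in> Obj C"
  shows "\<r> (X \<otimes> Y) = (\<one> X \<odot> \<r> Y) \<cdot> \<a> X Y \<I>"
  using monoidal_category.Lunit_TensO[OF monoidal_category_rev, of Y X, symmetric] assms by simp

section \<open>The functor and its structure morphisms\<close>

context multiplier_bimonad
begin

lemma To_Obj [simp]: "X \<in> Obj C \<Longrightarrow> To X \<in> Obj C"
  by (rule T.map_Obj)

declare T.map_Idn [simp]

lemma T_inv_Comp [simp]:
  assumes "is_iso C f"
  shows "Ta (inv_arr C f) \<cdot> Ta f = \<one> (To (Dom C f))" "Ta f \<cdot> Ta (inv_arr C f) = \<one> (To (Cod C f))"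
  using T.map_iso[OF assms] inv_Comp[of "Ta f"] assms is_iso_Arr by simp_all

lemma T2h_Arr [simp]:
  assumes "X \<in> Obj C" "Y \<in> Obj C"
  shows "T2h X Y \<in> Arr C" "Dom C (T2h X Y) = To (X \<otimes> To Y)" "Cod C (T2h X Y) = To X \<otimes> To Y"
  using hat.natural_Arr[of "(X, Y)"] assms by simp_all

lemma T2c_Arr [simp]:
  assumes "X \<in> Obj C" "Y \<in> Obj C"
  shows "T2c X Y \<in> Arr C" "Dom C (T2c X Y) = To (To X \<otimes> Y)" "Cod C (T2c X Y) = To X \<otimes> To Y"
  using check.natural_Arr[of "(X, Y)"] assms by simp_all

lemma T2h_natural:
  assumes "f \<in> Arr C" "g \<in> Arr C"
  shows "T2h (Cod C f) (Cod C g) \<cdot> Ta (f \<odot> Ta g) = (Ta f \<odot> Ta g) \<cdot> T2h (Dom C f) (Dom C g)"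
  using hat.naturality'[of "(f, g)"] assms by simp

lemma T2c_natural:
  assumes "f \<in> Arr C" "g \<in> Arr C"
  shows "T2c (Cod C f) (Cod C g) \<cdot> Ta (Ta f \<odot> g) = (Ta f \<odot> Ta g) \<cdot> T2c (Dom C f) (Dom C g)"
  using check.naturality'[of "(f, g)"] assms by simp

text \<open>
  Oriented so that arrows move from the codomain of \<open>T2h\<close> to its domain, where they stand inside \<open>T\<close>.
\<close>

lemma T2h_whisker:
  assumes "f \<in> Arr C" "Dom C f = X" "Y \<in> Obj C"
  shows "(Ta f \<odot> \<one> (To Y)) \<cdot> T2h X Y = T2h (Cod C f) Y \<cdot> Ta (f \<odot> \<one> (To Y))"
    "(\<one> (To Y) \<odot> Ta f) \<cdot> T2h Y X = T2h Y (Cod C f) \<cdot> Ta (\<one> Y \<odot> Ta f)"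
  using T2h_natural[of f "\<one> Y"] T2h_natural[of "\<one> Y" f] assms by simp_all

lemma T2c_whisker:
  assumes "f \<in> Arr C" "Dom C f = X" "Y \<in> Obj C"
  shows "(Ta f \<odot> \<one> (To Y)) \<cdot> T2c X Y = T2c (Cod C f) Y \<cdot> Ta (Ta f \<odot> \<one> Y)"
    "(\<one> (To Y) \<odot> Ta f) \<cdot> T2c Y X = T2c Y (Cod C f) \<cdot> Ta (\<one> (To Y) \<odot> f)"
  using T2c_natural[of f "\<one> Y"] T2c_natural[of "\<one> Y" f] assms by simp_all

lemma T0_Arr [simp]: "T0 \<in> Arr C" "Dom C T0 = To \<I>" "Cod C T0 = \<I>"
  using T0_in_hom by (simp_all add: hom_def)

section \<open>One-sided modules and their products\<close>

text \<open>
  One half of a module: the data and axioms that involve only the action \<open>qh\<close>.  The other half is the same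
  notion in the reversed category, where \<open>T2h\<close> and \<open>T2c\<close> trade places; for this reason the
  compatibility of \<open>qh\<close> with \<open>T2c\<close> is included here.
\<close>

definition hat_module :: "'o \<Rightarrow> ('o \<Rightarrow> 'a) \<Rightarrow> bool" where
  "hat_module Q qh \<longleftrightarrow> Q \<in> Obj C \<and>
    (\<forall>X \<in> Obj C. qh X \<in> hom C (To (X \<otimes> Q)) (To X \<otimes> Q)) \<and>
    (\<forall>f \<in> Arr C. qh (Cod C f) \<cdot> Ta (f \<odot> \<one> Q) = (Ta f \<odot> \<one> Q) \<cdot> qh (Dom C f)) \<and>
    (\<forall>X \<in> Obj C. \<forall>Y \<in> Obj C.
      \<a> (To X) (To Y) Q \<cdot> (T2h X Y \<odot> \<one> Q) \<cdot> qh (X \<otimes> To Y) \<cdot> Ta (\<a>\<^sup>- X (To Y) Q) \<cdot> Ta (\<one> X \<odot> qh Y)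
      = (\<one> (To X) \<odot> qh Y) \<cdot> T2h X (Y \<otimes> Q)) \<and>
    (\<forall>X \<in> Obj C. \<forall>Y \<in> Obj C.
      \<a> (To X) (To Y) Q \<cdot> (T2c X Y \<odot> \<one> Q) \<cdot> qh (To X \<otimes> Y)
      = (\<one> (To X) \<odot> qh Y) \<cdot> T2c X (Y \<otimes> Q) \<cdot> Ta (\<a> (To X) Y Q))"

definition hat_morphism :: "'o \<Rightarrow> ('o \<Rightarrow> 'a) \<Rightarrow> 'a \<Rightarrow> 'o \<Rightarrow> ('o \<Rightarrow> 'a) \<Rightarrow> bool" where
  "hat_morphism P ph f Q qh \<longleftrightarrow> f \<in> hom C P Q \<and>
    (\<forall>X \<in> Obj C. (\<one> (To X) \<odot> f) \<cdot> ph X = qh X \<cdot> Ta (\<one> X \<odot> f))"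

definition hat_tensor :: "'o \<Rightarrow> ('o \<Rightarrow> 'a) \<Rightarrow> 'o \<Rightarrow> ('o \<Rightarrow> 'a) \<Rightarrow> 'o \<Rightarrow> 'a" where
  "hat_tensor P ph Q qh =
    (\<lambda>X \<in> Obj C. \<a> (To X) P Q \<cdot> (ph X \<odot> \<one> Q) \<cdot> qh (X \<otimes> P) \<cdot> Ta (\<a>\<^sup>- X P Q))"

definition hat_unit :: "'o \<Rightarrow> 'a" where
  "hat_unit = (\<lambda>X \<in> Obj C. inv_arr C (\<r> (To X)) \<cdot> Ta (\<r> X))"

text \<open>
  The morphism \<open>q : TQ \<rightarrow> Q\<close> of the introduction.
\<close>

definition hat_counit :: "'o \<Rightarrow> ('o \<Rightarrow> 'a) \<Rightarrow> 'a" where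
  "hat_counit Q qh = \<l> Q \<cdot> (T0 \<odot> \<one> Q) \<cdot> qh \<I> \<cdot> Ta (inv_arr C (\<l> Q))"

lemma hat_module_Obj: "hat_module Q qh \<Longrightarrow> Q \<in> Obj C"
  by (simp add: hat_module_def)

lemma hat_module_Arr:
  assumes "hat_module Q qh" "X \<in> Obj C"
  shows "qh X \<in> Arr C" "Dom C (qh X) = To (X \<otimes> Q)" "Cod C (qh X) = To X \<otimes> Q"
  using assms by (simp_all add: hat_module_def hom_def)

lemma hat_module_natural:
  assumes "hat_module Q qh" "f \<in> Arr C" "Dom C f = X"
  shows "(Ta f \<odot> \<one> Q) \<cdot> qh X = qh (Cod C f) \<cdot> Ta (f \<odot> \<one> Q)"
  using assms by (simp add: hat_module_def)

lemma hat_module_assoc: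
  assumes "hat_module Q qh" "X \<in> Obj C" "Y \<in> Obj C"
  shows "(\<one> (To X) \<odot> qh Y) \<cdot> T2h X (Y \<otimes> Q) =
    \<a> (To X) (To Y) Q \<cdot> (T2h X Y \<odot> \<one> Q) \<cdot> qh (X \<otimes> To Y) \<cdot> Ta (\<a>\<^sup>- X (To Y) Q) \<cdot> Ta (\<one> X \<odot> qh Y)"
  using assms by (simp add: hat_module_def)

lemma hat_module_mixed:
  assumes "hat_module Q qh" "X \<in> Obj C" "Y \<in> Obj C"
  shows "(\<one> (To X) \<odot> qh Y) \<cdot> T2c X (Y \<otimes> Q) \<cdot> Ta (\<a> (To X) Y Q) =
    \<a> (To X) (To Y) Q \<cdot> (T2c X Y \<odot> \<one> Q) \<cdot> qh (To X \<otimes> Y)"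
  using assms by (simp add: hat_module_def)

text \<open>
  The same compatibility with the associator moved to the other side: the left-hand side is then a word that
  occurs in calculations.
\<close>

lemma hat_module_mixed':
  assumes "hat_module Q qh" "X \<in> Obj C" "Y \<in> Obj C"
  shows "(\<one> (To X) \<odot> qh Y) \<cdot> T2c X (Y \<otimes> Q) =
    \<a> (To X) (To Y) Q \<cdot> (T2c X Y \<odot> \<one> Q) \<cdot> qh (To X \<otimes> Y) \<cdot> Ta (\<a>\<^sup>- (To X) Y Q)"
proof -
  note [simp] = hat_module_Obj[OF assms(1)] hat_module_Arr[OF assms(1)] assms(2,3)
  have "(\<one> (To X) \<odot> qh Y) \<cdot> T2c X (Y \<otimes> Q)
      = ((\<one> (To X) \<odot> qh Y) \<cdot> T2c X (Y \<otimes> Q) \<cdot> Ta (\<a> (To X) Y Q)) \<cdot> Ta (\<a>\<^sup>- (To X) Y Q)"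
    by simp
  then show ?thesis
    unfolding hat_module_mixed[OF assms] by simp
qed

text \<open>
  In a strict monoidal category the compatibility of the action with \<open>T2h\<close>, or with \<open>T2c\<close>, for \<open>P \<otimes> Q\<close> is that for \<open>Q\<close>,
  followed by that for \<open>P\<close> tensored with \<open>Q\<close> and the naturality of \<open>qh\<close>.  The associators that remain cancel by one pentagon
  outside \<open>T\<close> and one inside it.
\<close>

lemma hat_tensor_module:
  assumes P: "hat_module P ph" and Q: "hat_module Q qh"
  shows "hat_module (P \<otimes> Q) (hat_tensor P ph Q qh)"
proof -
  let ?rh = "hat_tensor P ph Q qh"
  note [simp] = hat_module_Obj[OF P] hat_module_Arr[OF P] hat_module_Obj[OF Q] hat_module_Arr[OF Q]
  have rh [simp]: "?rh X = \<a> (To X) P Q \<cdot> (ph X \<odot> \<one> Q) \<cdot> qh (X \<otimes> P) \<cdot> Ta (\<a>\<^sup>- X P Q)"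
    if "X \<in> Obj C" for X
    using that by (simp add: hat_tensor_def)
  show ?thesis
    unfolding hat_module_def
  proof (intro conjI ballI)
    fix f assume [simp]: "f \<in> Arr C"
    have 1: "(Ta f \<odot> \<one> (P \<otimes> Q)) \<cdot> \<a> (To (Dom C f)) P Q
        = \<a> (To (Cod C f)) P Q \<cdot> ((Ta f \<odot> \<one> P) \<odot> \<one> Q)"
      by (simp add: Assoc_whisker)
    have 2: "((Ta f \<odot> \<one> P) \<odot> \<one> Q) \<cdot> (ph (Dom C f) \<odot> \<one> Q)
        = (ph (Cod C f) \<odot> \<one> Q) \<cdot> (Ta (f \<odot> \<one> P) \<odot> \<one> Q)"
      using arg_cong[where f = "\<lambda>u. u \<odot> \<one> Q", OF hat_module_natural[OF P, of f]] by simp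
    have 3: "Ta ((f \<odot> \<one> P) \<odot> \<one> Q) \<cdot> Ta (\<a>\<^sup>- (Dom C f) P Q)
        = Ta (\<a>\<^sup>- (Cod C f) P Q) \<cdot> Ta (f \<odot> \<one> (P \<otimes> Q))"
      using arg_cong[OF Assoc_inv_whisker(1)[of f "Cod C f" P Q], of Ta] by simp
    show "?rh (Cod C f) \<cdot> Ta (f \<odot> \<one> (P \<otimes> Q)) = (Ta f \<odot> \<one> (P \<otimes> Q)) \<cdot> ?rh (Dom C f)"
      by (simp add: 1[THEN extend2] 2[THEN extend2] 3 hat_module_natural[OF Q, THEN extend2])
  next
    fix X Y assume [simp]: "X \<in> Obj C" "Y \<in> Obj C"
    \<comment> \<open>The associativity axiom for \<open>P\<close>, tensored with \<open>Q\<close>.\<close>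
    have p: "((\<one> (To X) \<odot> ph Y) \<odot> \<one> Q) \<cdot> (T2h X (Y \<otimes> P) \<odot> \<one> Q)
        = (\<a> (To X) (To Y) P \<odot> \<one> Q) \<cdot> ((T2h X Y \<odot> \<one> P) \<odot> \<one> Q) \<cdot> (ph (X \<otimes> To Y) \<odot> \<one> Q)
          \<cdot> (Ta (\<a>\<^sup>- X (To Y) P) \<odot> \<one> Q) \<cdot> (Ta (\<one> X \<odot> ph Y) \<odot> \<one> Q)"
      using arg_cong[where f = "\<lambda>u. u \<odot> \<one> Q", OF hat_module_assoc[OF P, of X Y]] by simp
    \<comment> \<open>The pentagon inside \<open>T\<close>.\<close>
    have "\<a>\<^sup>- (X \<otimes> To Y) P Q \<cdot> \<a>\<^sup>- X (To Y) (P \<otimes> Q) \<cdot> (\<one> X \<odot> \<a> (To Y) P Q) \<cdot> (\<one> X \<odot> ph Y \<odot> \<one> Q)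
        = (\<a>\<^sup>- X (To Y) P \<odot> \<one> Q) \<cdot> ((\<one> X \<odot> ph Y) \<odot> \<one> Q) \<cdot> \<a>\<^sup>- X (To (Y \<otimes> P)) Q"
      by (simp add: pentagon'[THEN extend2] Assoc_inv_whisker)
    from arg_cong[OF this, of Ta]
    have t: "Ta (\<a>\<^sup>- (X \<otimes> To Y) P Q) \<cdot> Ta (\<a>\<^sup>- X (To Y) (P \<otimes> Q)) \<cdot> Ta (\<one> X \<odot> \<a> (To Y) P Q)
          \<cdot> Ta (\<one> X \<odot> ph Y \<odot> \<one> Q)
        = Ta (\<a>\<^sup>- X (To Y) P \<odot> \<one> Q) \<cdot> Ta ((\<one> X \<odot> ph Y) \<odot> \<one> Q) \<cdot> Ta (\<a>\<^sup>- X (To (Y \<otimes> P)) Q)"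
      by simp
    show "\<a> (To X) (To Y) (P \<otimes> Q) \<cdot> (T2h X Y \<odot> \<one> (P \<otimes> Q)) \<cdot> ?rh (X \<otimes> To Y)
          \<cdot> Ta (\<a>\<^sup>- X (To Y) (P \<otimes> Q)) \<cdot> Ta (\<one> X \<odot> ?rh Y)
        = (\<one> (To X) \<odot> ?rh Y) \<cdot> T2h X (Y \<otimes> P \<otimes> Q)"
      by (simp add: Assoc_whisker[THEN extend2] T2h_whisker hat_module_assoc[OF Q, THEN extend2]
          p[THEN extend2] pentagon[THEN extend3] hat_module_natural[OF Q, THEN extend2] t[THEN extend4])
    \<comment> \<open>The compatibility of \<open>ph\<close> with \<open>T2c\<close>, tensored with \<open>Q\<close>.\<close>
    have p: "((\<one> (To X) \<odot> ph Y) \<odot> \<one> Q) \<cdot> (T2c X (Y \<otimes> P) \<odot> \<one> Q)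
        = (\<a> (To X) (To Y) P \<odot> \<one> Q) \<cdot> ((T2c X Y \<odot> \<one> P) \<odot> \<one> Q) \<cdot> (ph (To X \<otimes> Y) \<odot> \<one> Q)
          \<cdot> (Ta (\<a>\<^sup>- (To X) Y P) \<odot> \<one> Q)"
      using arg_cong[where f = "\<lambda>u. u \<odot> \<one> Q", OF hat_module_mixed'[OF P, of X Y]] by simp
    have t: "Ta (\<a>\<^sup>- (To X) Y P \<odot> \<one> Q) \<cdot> Ta (\<a>\<^sup>- (To X) (Y \<otimes> P) Q) \<cdot> Ta (\<one> (To X) \<odot> \<a>\<^sup>- Y P Q)
        \<cdot> Ta (\<a> (To X) Y (P \<otimes> Q)) = Ta (\<a>\<^sup>- (To X \<otimes> Y) P Q)"
      using arg_cong[where f = "\<lambda>u. Ta (u \<cdot> \<a> (To X) Y (P \<otimes> Q))", OF pentagon'[of "To X" Y P Q]]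
      by simp
    show "\<a> (To X) (To Y) (P \<otimes> Q) \<cdot> (T2c X Y \<odot> \<one> (P \<otimes> Q)) \<cdot> ?rh (To X \<otimes> Y)
        = (\<one> (To X) \<odot> ?rh Y) \<cdot> T2c X (Y \<otimes> P \<otimes> Q) \<cdot> Ta (\<a> (To X) Y (P \<otimes> Q))"
      by (simp add: Assoc_whisker[THEN extend2] T2c_whisker[THEN extend2] hat_module_mixed'[OF Q, THEN extend2]
          p[THEN extend2] pentagon[THEN extend3] hat_module_natural[OF Q, THEN extend2] t)
  qed (simp_all add: hom_def)
qed

section \<open>The unit module and morphisms of one-sided modules\<close>

lemma hat_unit_module: "hat_module \<I> hat_unit"
proof -
  have [simp]: "hat_unit X = inv_arr C (\<r> (To X)) \<cdot> Ta (\<r> X)" if "X \<in> Obj C" for X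
    using that by (simp add: hat_unit_def)
  have r: "inv_arr C (\<r> (X \<otimes> Y)) = \<a>\<^sup>- X Y \<I> \<cdot> (\<one> X \<odot> inv_arr C (\<r> Y))"
    if "X \<in> Obj C" "Y \<in> Obj C" for X Y
    using that by (simp add: Runit_TensO is_iso_Comp)
  have nat: "(f \<odot> \<one> \<I>) \<cdot> inv_arr C (\<r> (Dom C f)) = inv_arr C (\<r> (Cod C f)) \<cdot> f" if "f \<in> Arr C" for f
    using that by (simp add: Runit_inv_natural)
  show ?thesis
    unfolding hat_module_def
  proof (intro conjI ballI)
    fix f assume [simp]: "f \<in> Arr C"
    have "Ta (\<r> (Cod C f)) \<cdot> Ta (f \<odot> \<one> \<I>) = Ta f \<cdot> Ta (\<r> (Dom C f))"
      using arg_cong[OF Runit_natural[of f], of Ta] by simp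
    then show "hat_unit (Cod C f) \<cdot> Ta (f \<odot> \<one> \<I>) = (Ta f \<odot> \<one> \<I>) \<cdot> hat_unit (Dom C f)"
      using nat[of "Ta f"] by (simp add: nat[of "Ta f", simplified, THEN extend2])
  next
    fix X Y assume [simp]: "X \<in> Obj C" "Y \<in> Obj C"
    have 1: "(T2h X Y \<odot> \<one> \<I>) \<cdot> inv_arr C (\<r> (To (X \<otimes> To Y)))
        = inv_arr C (\<r> (To X \<otimes> To Y)) \<cdot> T2h X Y"
      using nat[of "T2h X Y"] by simp
    have 2: "Ta (\<r> (X \<otimes> To Y)) \<cdot> Ta (\<a>\<^sup>- X (To Y) \<I>) = Ta (\<one> X \<odot> \<r> (To Y))"
      using arg_cong[OF Runit_TensO[of X "To Y"], of "\<lambda>u. Ta (u \<cdot> \<a>\<^sup>- X (To Y) \<I>)"] by simp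
    have 3: "Ta (\<one> X \<odot> \<r> (To Y)) \<cdot> Ta (\<one> X \<odot> inv_arr C (\<r> (To Y))) = \<one> (To (X \<otimes> To Y))"
      using T_inv_Comp(2)[of "\<one> X \<odot> \<r> (To Y)"] by simp
    show "\<a> (To X) (To Y) \<I> \<cdot> (T2h X Y \<odot> \<one> \<I>) \<cdot> hat_unit (X \<otimes> To Y)
          \<cdot> Ta (\<a>\<^sup>- X (To Y) \<I>) \<cdot> Ta (\<one> X \<odot> hat_unit Y)
        = (\<one> (To X) \<odot> hat_unit Y) \<cdot> T2h X (Y \<otimes> \<I>)"
      by (simp add: 1[THEN extend2] 2[THEN extend2] 3[THEN extend2] T2h_whisker r[of "To X" "To Y"])
    have 1: "(T2c X Y \<odot> \<one> \<I>) \<cdot> inv_arr C (\<r> (To (To X \<otimes> Y)))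
        = inv_arr C (\<r> (To X \<otimes> To Y)) \<cdot> T2c X Y"
      using nat[of "T2c X Y"] by simp
    have 2: "Ta (\<r> (To X \<otimes> Y)) = Ta (\<one> (To X) \<odot> \<r> Y) \<cdot> Ta (\<a> (To X) Y \<I>)"
      by (simp add: Runit_TensO)
    show "\<a> (To X) (To Y) \<I> \<cdot> (T2c X Y \<odot> \<one> \<I>) \<cdot> hat_unit (To X \<otimes> Y)
        = (\<one> (To X) \<odot> hat_unit Y) \<cdot> T2c X (Y \<otimes> \<I>) \<cdot> Ta (\<a> (To X) Y \<I>)"
      by (simp add: 1[THEN extend2] 2 T2c_whisker[THEN extend2] r[of "To X" "To Y"])
  qed (simp_all add: hom_def)
qed

lemma hat_morphism_Arr:
  "hat_morphism P ph f Q qh \<Longrightarrow> f \<in> Arr C" "hat_morphism P ph f Q qh \<Longrightarrow> Dom C f = P"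
  "hat_morphism P ph f Q qh \<Longrightarrow> Cod C f = Q"
  by (auto simp: hat_morphism_def hom_def)

lemma hat_morphism_eq:
  "hat_morphism P ph f Q qh \<Longrightarrow> X \<in> Obj C \<Longrightarrow> (\<one> (To X) \<odot> f) \<cdot> ph X = qh X \<cdot> Ta (\<one> X \<odot> f)"
  by (auto simp: hat_morphism_def)

lemma hat_morphism_Idn: "hat_module Q qh \<Longrightarrow> hat_morphism Q qh (\<one> Q) Q qh"
  by (auto simp: hat_morphism_def hom_def hat_module_Obj hat_module_Arr)

lemma hat_morphism_Comp:
  assumes "hat_morphism P ph f Q qh" "hat_morphism Q qh g R rh"
    and P: "hat_module P ph" and Q: "hat_module Q qh" and R: "hat_module R rh"
  shows "hat_morphism P ph (g \<cdot> f) R rh"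
proof -
  note [simp] = hat_module_Obj[OF P] hat_module_Arr[OF P] hat_module_Obj[OF Q] hat_module_Arr[OF Q]
    hat_module_Obj[OF R] hat_module_Arr[OF R]
    hat_morphism_Arr[OF assms(1)] hat_morphism_Arr[OF assms(2)]
  show ?thesis
    by (auto simp: hat_morphism_def hom_def hat_morphism_eq[OF assms(1)]
        hat_morphism_eq[OF assms(2), THEN extend2])
qed

lemma hat_morphism_inv:
  assumes f: "hat_morphism P ph f Q qh" "is_iso C f"
    and P: "hat_module P ph" and Q: "hat_module Q qh"
  shows "hat_morphism Q qh (inv_arr C f) P ph"
proof -
  note [simp] = hat_module_Obj[OF P] hat_module_Arr[OF P] hat_module_Obj[OF Q] hat_module_Arr[OF Q]
    hat_morphism_Arr[OF f(1)] f(2)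
  have "inv_arr C (\<one> (To X) \<odot> f) \<cdot> qh X = ph X \<cdot> inv_arr C (Ta (\<one> X \<odot> f))" if "X \<in> Obj C" for X
    by (rule inv_arr_natural[OF hat_morphism_eq[OF f(1) that]])
      (use that in \<open>simp_all add: T.map_iso\<close>)
  then show ?thesis
    by (auto simp: hat_morphism_def hom_def T.map_iso)
qed

text \<open>
  The morphism \<open>g\<close> passes \<open>ph\<close> by interchange and \<open>qh\<close> because it is a morphism; \<open>f\<close> passes \<open>ph\<close> because it
  is a morphism and \<open>qh'\<close> by naturality.
\<close>

lemma hat_morphism_tensor:
  assumes f: "hat_morphism P ph f P' ph'" and g: "hat_morphism Q qh g Q' qh'"
    and P: "hat_module P ph" and Q: "hat_module Q qh"
    and P': "hat_module P' ph'" and Q': "hat_module Q' qh'"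
  shows "hat_morphism (P \<otimes> Q) (hat_tensor P ph Q qh) (f \<odot> g) (P' \<otimes> Q') (hat_tensor P' ph' Q' qh')"
  unfolding hat_morphism_def
proof (intro conjI ballI)
  note [simp] = hat_module_Obj[OF P] hat_module_Arr[OF P] hat_module_Obj[OF Q] hat_module_Arr[OF Q]
    hat_module_Obj[OF P'] hat_module_Arr[OF P'] hat_module_Obj[OF Q'] hat_module_Arr[OF Q']
    hat_morphism_Arr[OF f] hat_morphism_Arr[OF g]
  show "f \<odot> g \<in> hom C (P \<otimes> Q) (P' \<otimes> Q')"
    by (simp add: hom_def)
  fix X assume [simp]: "X \<in> Obj C"
  have split: "\<one> Y \<odot> f \<odot> g = (\<one> Y \<odot> f \<odot> \<one> Q') \<cdot> (\<one> Y \<odot> \<one> P \<odot> g)" if "Y \<in> Obj C" for Y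
    using that by (simp add: TensA_split[of f g])
  have 1: "(\<one> (To X \<otimes> P) \<odot> g) \<cdot> (ph X \<odot> \<one> Q) = (ph X \<odot> \<one> Q') \<cdot> (\<one> (To (X \<otimes> P)) \<odot> g)"
    by (rule whisker_commute[symmetric]) simp_all
  have 2: "((\<one> (To X) \<odot> f) \<odot> \<one> Q') \<cdot> (ph X \<odot> \<one> Q') = (ph' X \<odot> \<one> Q') \<cdot> (Ta (\<one> X \<odot> f) \<odot> \<one> Q')"
    using arg_cong[where f = "\<lambda>u. u \<odot> \<one> Q'", OF hat_morphism_eq[OF f, of X]] by simp
  have "\<a>\<^sup>- X P' Q' \<cdot> (\<one> X \<odot> f \<odot> \<one> Q') \<cdot> (\<one> X \<odot> \<one> P \<odot> g)
      = ((\<one> X \<odot> f) \<odot> \<one> Q') \<cdot> (\<one> (X \<otimes> P) \<odot> g) \<cdot> \<a>\<^sup>- X P Q"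
    by (simp add: Assoc_inv_whisker Assoc_inv_whisker[THEN extend2])
  from arg_cong[OF this, of Ta]
  have 3: "Ta (\<a>\<^sup>- X P' Q') \<cdot> Ta (\<one> X \<odot> f \<odot> \<one> Q') \<cdot> Ta (\<one> X \<odot> \<one> P \<odot> g)
      = Ta ((\<one> X \<odot> f) \<odot> \<one> Q') \<cdot> Ta (\<one> (X \<otimes> P) \<odot> g) \<cdot> Ta (\<a>\<^sup>- X P Q)"
    by simp
  show "(\<one> (To X) \<odot> f \<odot> g) \<cdot> hat_tensor P ph Q qh X
      = hat_tensor P' ph' Q' qh' X \<cdot> Ta (\<one> X \<odot> f \<odot> g)"
    by (simp add: hat_tensor_def 3 split Assoc_whisker[THEN extend2] 1[THEN extend2] 2[THEN extend2]
        hat_morphism_eq[OF g, THEN extend2] hat_module_natural[OF Q', THEN extend2])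
qed

text \<open>
  Both bracketings let \<open>R\<close>, \<open>Q\<close> and \<open>P\<close> leave the argument of \<open>T\<close> in this order; the difference consists of one
  pentagon outside \<open>T\<close> and one inside.
\<close>

lemma hat_morphism_Assoc:
  assumes P: "hat_module P ph" and Q: "hat_module Q qh" and R: "hat_module R rh"
  shows "hat_morphism ((P \<otimes> Q) \<otimes> R) (hat_tensor (P \<otimes> Q) (hat_tensor P ph Q qh) R rh) (\<a> P Q R)
    (P \<otimes> Q \<otimes> R) (hat_tensor P ph (Q \<otimes> R) (hat_tensor Q qh R rh))"
  unfolding hat_morphism_def
proof (intro conjI ballI)
  note [simp] = hat_module_Obj[OF P] hat_module_Arr[OF P] hat_module_Obj[OF Q] hat_module_Arr[OF Q]
    hat_module_Obj[OF R] hat_module_Arr[OF R]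
  show "\<a> P Q R \<in> hom C ((P \<otimes> Q) \<otimes> R) (P \<otimes> Q \<otimes> R)"
    by (simp add: hom_def)
  fix X assume [simp]: "X \<in> Obj C"
  have t: "Ta (\<a>\<^sup>- (X \<otimes> P) Q R) \<cdot> Ta (\<a>\<^sup>- X P (Q \<otimes> R)) \<cdot> Ta (\<one> X \<odot> \<a> P Q R)
      = Ta (\<a>\<^sup>- X P Q \<odot> \<one> R) \<cdot> Ta (\<a>\<^sup>- X (P \<otimes> Q) R)"
    using arg_cong[OF pentagon'[of X P Q R], of "\<lambda>u. Ta (u \<cdot> (\<one> X \<odot> \<a> P Q R))"] by simp
  show "(\<one> (To X) \<odot> \<a> P Q R) \<cdot> hat_tensor (P \<otimes> Q) (hat_tensor P ph Q qh) R rh X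
      = hat_tensor P ph (Q \<otimes> R) (hat_tensor Q qh R rh) X \<cdot> Ta (\<one> X \<odot> \<a> P Q R)"
    by (simp add: hat_tensor_def t Assoc_whisker[THEN extend2] pentagon[THEN extend3]
        hat_module_natural[OF R, THEN extend2])
qed

lemma hat_morphism_Lunit:
  assumes Q: "hat_module Q qh"
  shows "hat_morphism (\<I> \<otimes> Q) (hat_tensor \<I> hat_unit Q qh) (\<l> Q) Q qh"
  unfolding hat_morphism_def
proof (intro conjI ballI)
  note [simp] = hat_module_Obj[OF Q] hat_module_Arr[OF Q]
  show "\<l> Q \<in> hom C (\<I> \<otimes> Q) Q"
    by (simp add: hom_def)
  fix X assume [simp]: "X \<in> Obj C"
  have t: "Ta (\<r> X \<odot> \<one> Q) \<cdot> Ta (\<a>\<^sup>- X \<I> Q) = Ta (\<one> X \<odot> \<l> Q)"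
    using arg_cong[OF triangle'[of X Q], of Ta] by simp
  show "(\<one> (To X) \<odot> \<l> Q) \<cdot> hat_tensor \<I> hat_unit Q qh X = qh X \<cdot> Ta (\<one> X \<odot> \<l> Q)"
    by (simp add: hat_tensor_def hat_unit_def t triangle[THEN extend2]
        hat_module_natural[OF Q, THEN extend2])
qed

lemma hat_morphism_Runit:
  assumes Q: "hat_module Q qh"
  shows "hat_morphism (Q \<otimes> \<I>) (hat_tensor Q qh \<I> hat_unit) (\<r> Q) Q qh"
  unfolding hat_morphism_def
proof (intro conjI ballI)
  note [simp] = hat_module_Obj[OF Q] hat_module_Arr[OF Q]
  show "\<r> Q \<in> hom C (Q \<otimes> \<I>) Q"
    by (simp add: hom_def)
  fix X assume [simp]: "X \<in> Obj C"
  have t: "Ta (\<r> (X \<otimes> Q)) \<cdot> Ta (\<a>\<^sup>- X Q \<I>) = Ta (\<one> X \<odot> \<r> Q)"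
    by (simp add: Runit_TensO)
  have u: "(\<one> (To X) \<odot> \<r> Q) \<cdot> \<a> (To X) Q \<I> \<cdot> (qh X \<odot> \<one> \<I>) = qh X \<cdot> \<r> (To (X \<otimes> Q))"
    using Runit_natural[of "qh X"] by (simp add: Runit_TensO)
  show "(\<one> (To X) \<odot> \<r> Q) \<cdot> hat_tensor Q qh \<I> hat_unit X = qh X \<cdot> Ta (\<one> X \<odot> \<r> Q)"
    by (simp add: hat_tensor_def hat_unit_def t u[THEN extend3])
qed

section \<open>The morphism from \<open>TQ\<close> to \<open>Q\<close>\<close>

lemma hat_counit_Arr:
  assumes "hat_module Q qh"
  shows "hat_counit Q qh \<in> Arr C" "Dom C (hat_counit Q qh) = To Q" "Cod C (hat_counit Q qh) = Q"
  using assms by (simp_all add: hat_counit_def hat_module_Obj hat_module_Arr)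

text \<open>
  Since \<open>q\<close> is an epimorphism for modules, this determines \<open>qh\<close> by \<open>q\<close>.  It is the associativity axiom at
  \<open>Y = \<I>\<close>, composed with \<open>T\<^sub>0\<close> on the middle factor: the counit axiom of the bimonad then absorbs
  the component of \<open>T2h\<close> at \<open>X\<close> and \<open>\<I>\<close>.
\<close>

lemma hat_action_counit:
  assumes Q: "hat_module Q qh" and [simp]: "X \<in> Obj C"
  shows "qh X \<cdot> Ta (\<one> X \<odot> hat_counit Q qh) = (\<one> (To X) \<odot> hat_counit Q qh) \<cdot> T2h X Q"
proof -
  note [simp] = hat_module_Obj[OF Q] hat_module_Arr[OF Q]
  have u: "(\<r> (To X) \<odot> \<one> Q) \<cdot> ((\<one> (To X) \<odot> T0) \<odot> \<one> Q) \<cdot> (T2h X \<I> \<odot> \<one> Q)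
      = (Ta (\<r> X) \<odot> \<one> Q) \<cdot> (Ta (\<one> X \<odot> T0) \<odot> \<one> Q)"
    using arg_cong[where f = "\<lambda>u. u \<odot> \<one> Q", OF T2h_counit[of X]] by simp
  have "(\<r> X \<odot> \<one> Q) \<cdot> ((\<one> X \<odot> T0) \<odot> \<one> Q) \<cdot> \<a>\<^sup>- X (To \<I>) Q = (\<one> X \<odot> \<l> Q) \<cdot> (\<one> X \<odot> T0 \<odot> \<one> Q)"
    using Assoc_inv_whisker(2)[of T0 \<I> X Q, symmetric]
    by (simp add: triangle'[THEN extend2])
  from arg_cong[OF this, of Ta]
  have t: "Ta (\<r> X \<odot> \<one> Q) \<cdot> Ta ((\<one> X \<odot> T0) \<odot> \<one> Q) \<cdot> Ta (\<a>\<^sup>- X (To \<I>) Q)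
      = Ta (\<one> X \<odot> \<l> Q) \<cdot> Ta (\<one> X \<odot> T0 \<odot> \<one> Q)"
    by simp
  show ?thesis
    by (simp add: hat_counit_def T2h_whisker hat_module_assoc[OF Q, THEN extend2]
        Assoc_whisker[THEN extend2] triangle[THEN extend2] u[THEN extend3]
        hat_module_natural[OF Q, THEN extend2] t[THEN extend3])
qed

text \<open>
  The morphism \<open>\<mu>\<close> of the introduction, which plays the role of a multiplication of \<open>T\<close>.
\<close>

definition mult :: "'o \<Rightarrow> 'a" where
  "mult X = \<l> (To X) \<cdot> (T0 \<odot> \<one> (To X)) \<cdot> T2h \<I> X \<cdot> Ta (inv_arr C (\<l> (To X)))"

lemma mult_Arr [simp]:
  assumes "X \<in> Obj C"
  shows "mult X \<in> Arr C" "Dom C (mult X) = To (To X)" "Cod C (mult X) = To X"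
  using assms by (simp_all add: mult_def)

text \<open>
  This is \<open>hat_action_counit\<close> at \<open>X = \<I>\<close>, composed with \<open>T\<^sub>0\<close> on the first factor.
\<close>

lemma hat_counit_assoc:
  assumes Q: "hat_module Q qh"
  shows "hat_counit Q qh \<cdot> Ta (hat_counit Q qh) = hat_counit Q qh \<cdot> mult Q"
proof -
  let ?q = "hat_counit Q qh"
  note [simp] = hat_module_Obj[OF Q] hat_module_Arr[OF Q] hat_counit_Arr[OF Q]
  have t: "Ta (inv_arr C (\<l> Q)) \<cdot> Ta ?q = Ta (\<one> \<I> \<odot> ?q) \<cdot> Ta (inv_arr C (\<l> (To Q)))"
    using arg_cong[OF Lunit_inv_natural[of ?q], of Ta] by simp
  have "?q \<cdot> Ta ?q = \<l> Q \<cdot> (T0 \<odot> \<one> Q) \<cdot> qh \<I> \<cdot> Ta (inv_arr C (\<l> Q)) \<cdot> Ta ?q"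
    by (subst hat_counit_def) simp
  also have "\<dots> = \<l> Q \<cdot> (T0 \<odot> \<one> Q) \<cdot> (\<one> (To \<I>) \<odot> ?q) \<cdot> T2h \<I> Q \<cdot> Ta (inv_arr C (\<l> (To Q)))"
    by (simp add: t hat_action_counit[OF Q, THEN extend2])
  also have "\<dots> = \<l> Q \<cdot> (\<one> \<I> \<odot> ?q) \<cdot> (T0 \<odot> \<one> (To Q)) \<cdot> T2h \<I> Q \<cdot> Ta (inv_arr C (\<l> (To Q)))"
    by (simp add: whisker_commute[of T0 ?q, simplified, THEN extend2])
  also have "\<dots> = ?q \<cdot> mult Q"
    by (simp add: Lunit_natural[of ?q, simplified, THEN extend2] mult_def)
  finally show ?thesis .
qed

lemma hat_counit_tensor:
  assumes P: "hat_module P ph" and Q: "hat_module Q qh"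
  shows "hat_counit (P \<otimes> Q) (hat_tensor P ph Q qh) = (hat_counit P ph \<odot> \<one> Q) \<cdot> qh P"
proof -
  note [simp] = hat_module_Obj[OF P] hat_module_Arr[OF P] hat_module_Obj[OF Q] hat_module_Arr[OF Q]
  have "inv_arr C (\<l> P \<odot> \<one> Q) = \<a>\<^sup>- \<I> P Q \<cdot> inv_arr C (\<l> (P \<otimes> Q))"
    using Lunit_TensO[of P Q, symmetric] by (simp del: whisker_iso add: is_iso_Comp)
  then have t: "Ta (\<a>\<^sup>- \<I> P Q) \<cdot> Ta (inv_arr C (\<l> (P \<otimes> Q))) = Ta (inv_arr C (\<l> P) \<odot> \<one> Q)"
    using T.map_Comp'[of "inv_arr C (\<l> (P \<otimes> Q))" "\<a>\<^sup>- \<I> P Q"] by simp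
  show ?thesis
    by (simp add: hat_counit_def hat_tensor_def Assoc_whisker[THEN extend2] t
        Lunit_TensO[THEN extend2] hat_module_natural[OF Q])
qed

text \<open>
  By the preceding lemma the left-hand side is \<open>(p \<otimes> 1) qh T(p \<otimes> q)\<close>.  Naturality of \<open>qh\<close> and
  \<open>hat_action_counit\<close> turn it into \<open>(p T(p) \<otimes> q) T2h\<close>, where \<open>p T(p) = p \<mu>\<close>.
\<close>

lemma hat_counit_tensor_action:
  assumes P: "hat_module P ph" and Q: "hat_module Q qh"
  shows "hat_counit (P \<otimes> Q) (hat_tensor P ph Q qh) \<cdot> Ta (hat_counit P ph \<odot> hat_counit Q qh)
    = (hat_counit P ph \<odot> hat_counit Q qh) \<cdot> (mult P \<odot> \<one> (To Q)) \<cdot> T2h (To P) Q"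
proof -
  let ?p = "hat_counit P ph" and ?q = "hat_counit Q qh"
  note [simp] = hat_module_Obj[OF P] hat_module_Arr[OF P] hat_counit_Arr[OF P]
    hat_module_Obj[OF Q] hat_module_Arr[OF Q] hat_counit_Arr[OF Q]
  have split: "?p \<odot> ?q = (?p \<odot> \<one> Q) \<cdot> (\<one> (To P) \<odot> ?q)"
    by (simp add: TensA_split[of ?p ?q])
  have nat: "qh P \<cdot> Ta (?p \<odot> \<one> Q) = (Ta ?p \<odot> \<one> Q) \<cdot> qh (To P)"
    by (simp add: hat_module_natural[OF Q])
  have assoc: "(?p \<odot> \<one> Q) \<cdot> (Ta ?p \<odot> \<one> Q) = (?p \<odot> \<one> Q) \<cdot> (mult P \<odot> \<one> Q)"
    using arg_cong[where f = "\<lambda>u. u \<odot> \<one> Q", OF hat_counit_assoc[OF P]] by simp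
  have comm: "(mult P \<odot> \<one> Q) \<cdot> (\<one> (To (To P)) \<odot> ?q) = (\<one> (To P) \<odot> ?q) \<cdot> (mult P \<odot> \<one> (To Q))"
    by (rule whisker_commute) simp_all
  show ?thesis
    by (simp add: hat_counit_tensor[OF P Q] split nat[THEN extend2] assoc[THEN extend2]
        hat_action_counit[OF Q] comm[THEN extend2])
qed

lemma hat_counit_unit: "hat_counit \<I> hat_unit = T0"
proof -
  have "\<r> \<I> \<cdot> (T0 \<odot> \<one> \<I>) \<cdot> inv_arr C (\<r> (To \<I>)) = T0"
    by (simp add: Runit_natural[of T0, simplified, THEN extend2])
  then show ?thesis
    by (simp add: hat_counit_def hat_unit_def Lunit_UnitO)
qed

section \<open>Symmetry between the two sides\<close>

lemma T2c_counit_eq_mult: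
  "X \<in> Obj C \<Longrightarrow> \<r> (To X) \<cdot> (\<one> (To X) \<odot> T0) \<cdot> T2c X \<I> \<cdot> Ta (inv_arr C (\<r> (To X))) = mult X"
  by (simp add: mult_def T2h_T2c_counit)

text \<open>
  The two composites of the hypothesis of the theorem agree.  They arise from the two sides of the compatibility of
  \<open>T2h\<close> with \<open>T2c\<close>, taken at a middle object \<open>\<I>\<close>, by composing with \<open>T\<^sub>0\<close> on the middle factor: on one side
  \<open>T\<^sub>0\<close> meets \<open>T2c\<close>, on the other \<open>T2h\<close>, and both times the result is \<open>\<mu>\<close>.
\<close>

lemma mult_whisker_swap:
  assumes [simp]: "X \<in> Obj C" "Y \<in> Obj C"
  shows "(mult X \<odot> \<one> (To Y)) \<cdot> T2h (To X) Y = (\<one> (To X) \<odot> mult Y) \<cdot> T2c X (To Y)"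
proof -
  have m: "mult X \<odot> \<one> (To Y) = (\<r> (To X) \<odot> \<one> (To Y)) \<cdot> ((\<one> (To X) \<odot> T0) \<odot> \<one> (To Y))
      \<cdot> (T2c X \<I> \<odot> \<one> (To Y)) \<cdot> (Ta (inv_arr C (\<r> (To X))) \<odot> \<one> (To Y))"
    by (simp flip: T2c_counit_eq_mult)
  have "\<a>\<^sup>- (To X) (To \<I>) (To Y) \<cdot> (\<one> (To X) \<odot> T2h \<I> Y) \<cdot> T2c X (\<I> \<otimes> To Y) \<cdot> Ta (\<a> (To X) \<I> (To Y))
      = (T2c X \<I> \<odot> \<one> (To Y)) \<cdot> T2h (To X \<otimes> \<I>) Y"
    by (simp add: T2h_T2c)
  note h = this[symmetric]
  have u: "(\<r> (To X) \<odot> \<one> (To Y)) \<cdot> ((\<one> (To X) \<odot> T0) \<odot> \<one> (To Y)) \<cdot> \<a>\<^sup>- (To X) (To \<I>) (To Y)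
      = (\<one> (To X) \<odot> \<l> (To Y)) \<cdot> (\<one> (To X) \<odot> T0 \<odot> \<one> (To Y))"
    using Assoc_inv_whisker(2)[of T0 \<I> "To X" "To Y", symmetric]
    by (simp add: triangle'[THEN extend2])
  have "\<a> (To X) \<I> (To Y) \<cdot> (inv_arr C (\<r> (To X)) \<odot> \<one> (To Y)) = \<one> (To X) \<odot> inv_arr C (\<l> (To Y))"
    using arg_cong[OF triangle'[of "To X" "To Y"], of "inv_arr C"] by (simp add: is_iso_Comp)
  from arg_cong[OF this, of Ta]
  have t: "Ta (\<a> (To X) \<I> (To Y)) \<cdot> Ta (inv_arr C (\<r> (To X)) \<odot> \<one> (To Y))
      = Ta (\<one> (To X) \<odot> inv_arr C (\<l> (To Y)))"
    by simp
  show ?thesis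
    unfolding m
    by (simp add: T2h_whisker h[THEN extend2] u[THEN extend3] t mult_def T2c_whisker)
qed

text \<open>
  Each axiom becomes its mirror image with the associators moved to the other side; the compatibility
  of \<open>T2h\<close> with \<open>T2c\<close> and the last axiom become themselves.
\<close>

lemma multiplier_bimonad_rev:
  "multiplier_bimonad (rev_cat C) To Ta (\<lambda>X Y. T2c Y X) (\<lambda>X Y. T2h Y X) T0"
proof -
  have cat: "category (rev_cat C)" "category (rev_cat C \<times>\<^sub>c rev_cat C)"
    by (simp_all add: category_rev category_prod)
  have T_functor: "cat_functor (rev_cat C) (rev_cat C) To Ta"
    by (rule cat_functorI) (simp_all add: cat)
  have dist: "(f \<cdot> h) \<odot> (g \<cdot> k) = (f \<odot> g) \<cdot> (h \<odot> k)" if "f \<in> Arr C" "g \<in> Arr C" "h \<in> Arr C" "k \<in> Arr C"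
      "Cod C h = Dom C f" "Cod C k = Dom C g" for f g h k
    using that by (simp add: interchange)
  have functors:
    "cat_functor (rev_cat C \<times>\<^sub>c rev_cat C) (rev_cat C)
      (\<lambda>(X, Y). To (To Y \<otimes> X)) (\<lambda>(f, g). Ta (Ta g \<odot> f))"
    "cat_functor (rev_cat C \<times>\<^sub>c rev_cat C) (rev_cat C)
      (\<lambda>(X, Y). To (Y \<otimes> To X)) (\<lambda>(f, g). Ta (g \<odot> Ta f))"
    "cat_functor (rev_cat C \<times>\<^sub>c rev_cat C) (rev_cat C)
      (\<lambda>(X, Y). To Y \<otimes> To X) (\<lambda>(f, g). Ta g \<odot> Ta f)"
    by (rule cat_functorI; use cat in \<open>auto simp: dist\<close>)+
  have natural:
    "natural_transformation (rev_cat C \<times>\<^sub>c rev_cat C) (rev_cat C)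
      (\<lambda>(X, Y). To (To Y \<otimes> X)) (\<lambda>(f, g). Ta (Ta g \<odot> f))
      (\<lambda>(X, Y). To Y \<otimes> To X) (\<lambda>(f, g). Ta g \<odot> Ta f) (\<lambda>(X, Y). T2c Y X)"
    "natural_transformation (rev_cat C \<times>\<^sub>c rev_cat C) (rev_cat C)
      (\<lambda>(X, Y). To (Y \<otimes> To X)) (\<lambda>(f, g). Ta (g \<odot> Ta f))
      (\<lambda>(X, Y). To Y \<otimes> To X) (\<lambda>(f, g). Ta g \<odot> Ta f) (\<lambda>(X, Y). T2h Y X)"
    by (rule natural_transformationI; auto simp: functors T2c_natural T2h_natural)+
  have "\<a>\<^sup>- (To X) (To Y) (To Z) \<cdot> (\<one> (To X) \<odot> T2c Y Z) \<cdot> T2c X (To Y \<otimes> Z) \<cdot> Ta (\<a> (To X) (To Y) Z) \<cdot> Ta (T2c X Y \<odot> \<one> Z)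
      = (T2c X Y \<odot> \<one> (To Z)) \<cdot> T2c (To X \<otimes> Y) Z" if "X \<in> Obj C" "Y \<in> Obj C" "Z \<in> Obj C" for X Y Z
    using that by (simp add: T2c_coassoc)
  moreover have "(T2h X Y \<odot> \<one> (To Z)) \<cdot> T2h (X \<otimes> To Y) Z \<cdot> Ta (\<a>\<^sup>- X (To Y) (To Z)) \<cdot> Ta (\<one> X \<odot> T2h Y Z)
      = \<a>\<^sup>- (To X) (To Y) (To Z) \<cdot> (\<one> (To X) \<odot> T2h Y Z) \<cdot> T2h X (Y \<otimes> To Z)"
    if "X \<in> Obj C" "Y \<in> Obj C" "Z \<in> Obj C" for X Y Z
    using that by (simp flip: T2h_coassoc)
  moreover have "(T2c X Y \<odot> \<one> (To Z)) \<cdot> T2h (To X \<otimes> Y) Z \<cdot> Ta (\<a>\<^sup>- (To X) Y (To Z))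
      = \<a>\<^sup>- (To X) (To Y) (To Z) \<cdot> (\<one> (To X) \<odot> T2h Y Z) \<cdot> T2c X (Y \<otimes> To Z)"
    if [simp]: "X \<in> Obj C" "Y \<in> Obj C" "Z \<in> Obj C" for X Y Z
  proof -
    have "\<a>\<^sup>- (To X) (To Y) (To Z) \<cdot> ((\<one> (To X) \<odot> T2h Y Z) \<cdot> T2c X (Y \<otimes> To Z) \<cdot> Ta (\<a> (To X) Y (To Z)))
        \<cdot> Ta (\<a>\<^sup>- (To X) Y (To Z))
      = \<a>\<^sup>- (To X) (To Y) (To Z) \<cdot> (\<one> (To X) \<odot> T2h Y Z) \<cdot> T2c X (Y \<otimes> To Z)"
      by simp
    then show ?thesis
      unfolding T2h_T2c[OF that] by simp
  qed
  ultimately show ?thesis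
    by (intro multiplier_bimonad.intro multiplier_bimonad_axioms.intro)
      (simp_all add: monoidal_category_rev T_functor natural T0_in_hom T2h_counit T2c_counit T2h_T2c_counit)
qed

text \<open>
  The prefix \<open>R\<close> marks the notions and facts of the reversed bimonad: \<open>R.hat_module Q qc\<close> is the half of a module that
  concerns \<open>qc\<close>.
\<close>

interpretation R: multiplier_bimonad "rev_cat C" To Ta "\<lambda>X Y. T2c Y X" "\<lambda>X Y. T2h Y X" T0
  by (rule multiplier_bimonad_rev)

lemma R_mult [simp]: "X \<in> Obj C \<Longrightarrow> R.mult X = mult X"
  by (simp add: R.mult_def T2c_counit_eq_mult)

text \<open>
  Matches the mirrored axioms with those for \<open>qc\<close> in the definition of a module: only the associators
  change sides.
\<close>

lemma check_module_iff:
  "R.hat_module Q qc \<longleftrightarrow> Q \<in> Obj C \<and>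
    (\<forall>X \<in> Obj C. qc X \<in> hom C (To (Q \<otimes> X)) (Q \<otimes> To X)) \<and>
    (\<forall>f \<in> Arr C. qc (Cod C f) \<cdot> Ta (\<one> Q \<odot> f) = (\<one> Q \<odot> Ta f) \<cdot> qc (Dom C f)) \<and>
    (\<forall>X \<in> Obj C. \<forall>Y \<in> Obj C.
          (\<one> Q \<odot> T2c X Y) \<cdot> qc (To X \<otimes> Y) \<cdot> Ta (\<a> Q (To X) Y) \<cdot> Ta (qc X \<odot> \<one> Y)
          = \<a> Q (To X) (To Y) \<cdot> (qc X \<odot> \<one> (To Y)) \<cdot> T2c (Q \<otimes> X) Y) \<and>
    (\<forall>X \<in> Obj C. \<forall>Y \<in> Obj C.
          (\<one> Q \<odot> T2h X Y) \<cdot> qc (X \<otimes> To Y) \<cdot> Ta (\<a> Q X (To Y))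
          = \<a> Q (To X) (To Y) \<cdot> (qc X \<odot> \<one> (To Y)) \<cdot> T2h (Q \<otimes> X) Y)"
  (is "?L \<longleftrightarrow> ?Q \<and> ?A \<and> ?N \<and> ?R1 \<and> ?R2")
proof (cases "?Q \<and> ?A")
  case False
  then show ?thesis by (auto simp: R.hat_module_def)
next
  case True
  then have [simp]: "Q \<in> Obj C" by simp
  have q [simp]: "qc X \<in> Arr C" "Dom C (qc X) = To (Q \<otimes> X)" "Cod C (qc X) = Q \<otimes> To X"
    if "X \<in> Obj C" for X
    using True that by (simp_all add: hom_def)
  have 1: "\<a>\<^sup>- Q (To X) (To Y) \<cdot> (\<one> Q \<odot> T2c X Y) \<cdot> qc (To X \<otimes> Y) \<cdot> Ta (\<a> Q (To X) Y) \<cdot> Ta (qc X \<odot> \<one> Y)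
      = (qc X \<odot> \<one> (To Y)) \<cdot> T2c (Q \<otimes> X) Y \<longleftrightarrow>
      (\<one> Q \<odot> T2c X Y) \<cdot> qc (To X \<otimes> Y) \<cdot> Ta (\<a> Q (To X) Y) \<cdot> Ta (qc X \<odot> \<one> Y)
          = \<a> Q (To X) (To Y) \<cdot> (qc X \<odot> \<one> (To Y)) \<cdot> T2c (Q \<otimes> X) Y"
    if "X \<in> Obj C" "Y \<in> Obj C" for X Y
    using that by (intro inv_Comp_eq_iff) simp_all
  have 2: "\<a>\<^sup>- Q (To X) (To Y) \<cdot> (\<one> Q \<odot> T2h X Y) \<cdot> qc (X \<otimes> To Y)
      = (qc X \<odot> \<one> (To Y)) \<cdot> T2h (Q \<otimes> X) Y \<cdot> Ta (\<a>\<^sup>- Q X (To Y)) \<longleftrightarrow>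
      (\<one> Q \<odot> T2h X Y) \<cdot> qc (X \<otimes> To Y) \<cdot> Ta (\<a> Q X (To Y))
          = \<a> Q (To X) (To Y) \<cdot> (qc X \<odot> \<one> (To Y)) \<cdot> T2h (Q \<otimes> X) Y" (is "?l \<longleftrightarrow> ?r")
    if [simp]: "X \<in> Obj C" "Y \<in> Obj C" for X Y
  proof -
    have "?l \<longleftrightarrow> (\<one> Q \<odot> T2h X Y) \<cdot> qc (X \<otimes> To Y)
        = \<a> Q (To X) (To Y) \<cdot> (qc X \<odot> \<one> (To Y)) \<cdot> T2h (Q \<otimes> X) Y \<cdot> Ta (\<a>\<^sup>- Q X (To Y))"
      by (rule inv_Comp_eq_iff) simp_all
    also have "\<dots> \<longleftrightarrow> (\<a> Q (To X) (To Y) \<cdot> (qc X \<odot> \<one> (To Y)) \<cdot> T2h (Q \<otimes> X) Y) \<cdot> inv_arr C (Ta (\<a> Q X (To Y)))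
        = (\<one> Q \<odot> T2h X Y) \<cdot> qc (X \<otimes> To Y)"
      by (auto simp: T.map_iso)
    also have "\<dots> \<longleftrightarrow> (\<a> Q (To X) (To Y) \<cdot> (qc X \<odot> \<one> (To Y)) \<cdot> T2h (Q \<otimes> X) Y)
        = ((\<one> Q \<odot> T2h X Y) \<cdot> qc (X \<otimes> To Y)) \<cdot> Ta (\<a> Q X (To Y))"
      by (rule Comp_inv_eq_iff) (simp_all add: T.map_iso)
    also have "\<dots> \<longleftrightarrow> ?r"
      by auto
    finally show ?thesis .
  qed
  show ?thesis
    using True by (auto simp: R.hat_module_def 1 2)
qed

lemma module_iff:
  "multiplier_bimonad_module C To Ta T2h T2c T0 Q qh qc \<longleftrightarrow>
    hat_module Q qh \<and> R.hat_module Q qc \<and> hat_counit Q qh = R.hat_counit Q qc \<and>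
    split_epi C (hat_counit Q qh)" (is "?L \<longleftrightarrow> ?R")
proof
  assume ?L
  then interpret M: multiplier_bimonad_module C To Ta T2h T2c T0 Q qh qc .
  show ?R
    using M.Q_in_Obj M.qh.natural_Arr M.qh.naturality' M.qc.natural_Arr M.qc.naturality'
      M.qh_assoc M.qc_assoc M.T2c_qh M.T2h_qc M.qh_qc_counit M.qh_split_epi
    by (simp add: hat_module_def check_module_iff hom_def hat_counit_def R.hat_counit_def)
next
  assume R: ?R
  then have hat: "hat_module Q qh" and check: "R.hat_module Q qc"
    and counit: "hat_counit Q qh = R.hat_counit Q qc" "split_epi C (hat_counit Q qh)"
    by auto
  note [simp] = hat_module_Obj[OF hat] hat_module_Arr[OF hat] R.hat_module_Arr[OF check, simplified]
  have functors: "cat_functor C C (\<lambda>X. To (X \<otimes> Q)) (\<lambda>f. Ta (f \<odot> \<one> Q))"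
    "cat_functor C C (\<lambda>X. To X \<otimes> Q) (\<lambda>f. Ta f \<odot> \<one> Q)"
    "cat_functor C C (\<lambda>X. To (Q \<otimes> X)) (\<lambda>f. Ta (\<one> Q \<odot> f))"
    "cat_functor C C (\<lambda>X. Q \<otimes> To X) (\<lambda>f. \<one> Q \<odot> Ta f)"
    by (rule cat_functorI; simp add: category_axioms)+
  show ?L
  proof (intro multiplier_bimonad_module.intro multiplier_bimonad_module_axioms.intro
      natural_transformationI functors)
    show "multiplier_bimonad C To Ta T2h T2c T0"
      by (rule multiplier_bimonad_axioms)
  qed (use hat check[unfolded check_module_iff] counit in
      \<open>simp_all add: hat_module_def hat_counit_def R.hat_counit_def\<close>)
qed

lemma module_morphism_iff:
  "module_morphism C To Ta M f N \<longleftrightarrow>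
    hat_morphism (carr M) (act_hat M) f (carr N) (act_hat N) \<and>
    R.hat_morphism (carr M) (act_check M) f (carr N) (act_check N)"
  by (auto simp: module_morphism_def hat_morphism_def R.hat_morphism_def)

end

section \<open>The monoidal category of modules\<close>

text \<open>
  The second assumption concerns the composite \<open>T(TX \<otimes> TY) \<rightarrow> TX \<otimes> TY\<close> through \<open>T2h\<close>, written in terms of \<open>\<mu>\<close>.
\<close>

locale split_multiplier_bimonad = multiplier_bimonad C To Ta T2h T2c T0
  for C :: "('o, 'a, 'z) moncat_scheme" (structure)
    and To :: "'o \<Rightarrow> 'o" and Ta :: "'a \<Rightarrow> 'a"
    and T2h :: "'o \<Rightarrow> 'o \<Rightarrow> 'a" and T2c :: "'o \<Rightarrow> 'o \<Rightarrow> 'a" and T0 :: "'a" +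
  assumes T0_split_epi: "split_epi C T0"
    and mult_split_epi: "X \<in> Obj C \<Longrightarrow> Y \<in> Obj C \<Longrightarrow>
      split_epi C ((mult X \<odot> \<one> (To Y)) \<cdot> T2h (To X) Y)"
begin

interpretation R: multiplier_bimonad "rev_cat C" To Ta "\<lambda>X Y. T2c Y X" "\<lambda>X Y. T2h Y X" T0
  by (rule multiplier_bimonad_rev)

text \<open>
  The two one-sided structures are given by \<open>hat_tensor_module\<close> and its mirror image.  They are compatible because
  the two morphisms \<open>T(P \<otimes> Q) \<rightarrow> P \<otimes> Q\<close> agree after composition with the epimorphism \<open>T(p \<otimes> q)\<close>.
\<close>

lemma tensor_module:
  assumes P: "multiplier_bimonad_module C To Ta T2h T2c T0 P ph pc"
    and Q: "multiplier_bimonad_module C To Ta T2h T2c T0 Q qh qc"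
  shows "multiplier_bimonad_module C To Ta T2h T2c T0 (P \<otimes> Q)
    (hat_tensor P ph Q qh) (R.hat_tensor Q qc P pc)"
proof -
  let ?p = "hat_counit P ph" and ?q = "hat_counit Q qh"
  let ?e = "?p \<odot> ?q" and ?m = "(mult P \<odot> \<one> (To Q)) \<cdot> T2h (To P) Q"
  have P': "hat_module P ph" "R.hat_module P pc" "?p = R.hat_counit P pc" "split_epi C ?p"
    and Q': "hat_module Q qh" "R.hat_module Q qc" "?q = R.hat_counit Q qc" "split_epi C ?q"
    using P Q by (auto simp: module_iff)
  note [simp] = hat_module_Obj[OF P'(1)] hat_counit_Arr[OF P'(1)]
    hat_module_Obj[OF Q'(1)] hat_counit_Arr[OF Q'(1)]
  have hat: "hat_module (P \<otimes> Q) (hat_tensor P ph Q qh)"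
    by (rule hat_tensor_module[OF P'(1) Q'(1)])
  have check: "R.hat_module (P \<otimes> Q) (R.hat_tensor Q qc P pc)"
    using R.hat_tensor_module[OF Q'(2) P'(2)] by simp
  let ?u = "hat_counit (P \<otimes> Q) (hat_tensor P ph Q qh)"
    and ?v = "R.hat_counit (P \<otimes> Q) (R.hat_tensor Q qc P pc)"
  have u: "?u \<cdot> Ta ?e = ?e \<cdot> ?m"
    by (rule hat_counit_tensor_action[OF P'(1) Q'(1)])
  have "?v \<cdot> Ta ?e = ?e \<cdot> (\<one> (To P) \<odot> mult Q) \<cdot> T2c P (To Q)"
    using R.hat_counit_tensor_action[OF Q'(2) P'(2)] P'(3) Q'(3) by simp
  then have v: "?v \<cdot> Ta ?e = ?e \<cdot> ?m"
    by (simp add: mult_whisker_swap)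
  have e: "split_epi C ?e"
    by (rule split_epi_TensA[OF P'(4) Q'(4)])
  have "?u = ?v"
    by (rule split_epi_epic[OF T.map_split_epi[OF e]])
      (use u v hat_counit_Arr[OF hat] R.hat_counit_Arr[OF check] in simp_all)
  moreover have "split_epi C (?u \<cdot> Ta ?e)"
    unfolding u by (intro split_epi_Comp mult_split_epi e) simp_all
  then have "split_epi C ?u"
    by (rule split_epi_cancel) (use hat_counit_Arr[OF hat] in simp_all)
  ultimately show ?thesis
    using hat check by (simp add: module_iff)
qed

lemma unit_module: "multiplier_bimonad_module C To Ta T2h T2c T0 \<I> hat_unit R.hat_unit"
  using hat_unit_module R.hat_unit_module hat_counit_unit R.hat_counit_unit T0_split_epi
  by (simp add: module_iff)

text \<open>
  In the reversed category the factors of \<open>P \<otimes> Q\<close> change places, hence the order of the arguments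
  of the last field.
\<close>

definition module_tensor :: "('o, 'a) tmodule \<Rightarrow> ('o, 'a) tmodule \<Rightarrow> ('o, 'a) tmodule" where
  "module_tensor M N =
    \<lparr> carr = carr M \<otimes> carr N,
      act_hat = hat_tensor (carr M) (act_hat M) (carr N) (act_hat N),
      act_check = R.hat_tensor (carr N) (act_check N) (carr M) (act_check M) \<rparr>"

definition module_unit :: "('o, 'a) tmodule" where
  "module_unit = \<lparr> carr = \<I>, act_hat = hat_unit, act_check = R.hat_unit \<rparr>"

definition module_moncat ::
  "(('o, 'a) tmodule, ('o, 'a) tmodule \<times> 'a \<times> ('o, 'a) tmodule) moncat" where
  "module_moncat = cat.extend (module_cat C To Ta T2h T2c T0)
    \<lparr> TensO = module_tensor,
      TensA = (\<lambda>(M, f, N) (M', g, N'). (module_tensor M M', f \<odot> g, module_tensor N N')),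
      UnitO = module_unit,
      Assoc = (\<lambda>L M N. (module_tensor (module_tensor L M) N, \<a> (carr L) (carr M) (carr N),
        module_tensor L (module_tensor M N))),
      Lunit = (\<lambda>M. (module_tensor module_unit M, \<l> (carr M), M)),
      Runit = (\<lambda>M. (module_tensor M module_unit, \<r> (carr M), M)) \<rparr>"

abbreviation module_arrow :: "('o, 'a) tmodule \<Rightarrow> 'a \<Rightarrow> ('o, 'a) tmodule \<Rightarrow> bool" where
  "module_arrow M f N \<equiv> M \<in> modules C To Ta T2h T2c T0 \<and> N \<in> modules C To Ta T2h T2c T0 \<and>
    module_morphism C To Ta M f N"

lemma module_moncat_simps [simp]:
  "Obj module_moncat = modules C To Ta T2h T2c T0"
  "(M, f, N) \<in> Arr module_moncat \<longleftrightarrow> module_arrow M f N"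
  "Dom module_moncat (M, f, N) = M" "Cod module_moncat (M, f, N) = N"
  "\<one>\<^bsub>module_moncat\<^esub> M = (M, \<one> (carr M), M)"
  "(N', g, P) \<cdot>\<^bsub>module_moncat\<^esub> (M, f, N) = (M, g \<cdot> f, P)"
  "M \<otimes>\<^bsub>module_moncat\<^esub> N = module_tensor M N"
  "(M, f, N) \<odot>\<^bsub>module_moncat\<^esub> (M', g, N') = (module_tensor M M', f \<odot> g, module_tensor N N')"
  "\<I>\<^bsub>module_moncat\<^esub> = module_unit"
  "\<a>\<^bsub>module_moncat\<^esub> L M N = (module_tensor (module_tensor L M) N, \<a> (carr L) (carr M) (carr N),
        module_tensor L (module_tensor M N))"
  "\<l>\<^bsub>module_moncat\<^esub> M = (module_tensor module_unit M, \<l> (carr M), M)"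
  "\<r>\<^bsub>module_moncat\<^esub> M = (module_tensor M module_unit, \<r> (carr M), M)"
  by (simp_all add: module_moncat_def module_cat_def cat.extend_def)

lemma truncate_module_moncat: "cat.truncate module_moncat = module_cat C To Ta T2h T2c T0"
  by (simp add: module_moncat_def module_cat_def cat.extend_def cat.truncate_def)

lemma modulesD:
  assumes "M \<in> modules C To Ta T2h T2c T0"
  shows "hat_module (carr M) (act_hat M)" "R.hat_module (carr M) (act_check M)" "carr M \<in> Obj C"
  using assms by (auto simp: modules_def module_iff hat_module_Obj)

lemma module_tensor_modules [simp]:
  "M \<in> modules C To Ta T2h T2c T0 \<Longrightarrow> N \<in> modules C To Ta T2h T2c T0 \<Longrightarrow>
    module_tensor M N \<in> modules C To Ta T2h T2c T0"
  by (simp add: modules_def module_tensor_def tensor_module) (simp add: hat_tensor_def R.hat_tensor_def)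

lemma module_unit_modules [simp]: "module_unit \<in> modules C To Ta T2h T2c T0"
  by (simp add: modules_def module_unit_def unit_module) (simp add: hat_unit_def R.hat_unit_def)

lemma carr_simps [simp]: "carr (module_tensor M N) = carr M \<otimes> carr N" "carr module_unit = \<I>"
  by (simp_all add: module_tensor_def module_unit_def)

lemma module_morphism_Arr:
  assumes "module_morphism C To Ta M f N"
  shows "f \<in> Arr C" "Dom C f = carr M" "Cod C f = carr N"
  using assms by (auto simp: module_morphism_def hom_def)

lemma module_morphism_Idn: "M \<in> modules C To Ta T2h T2c T0 \<Longrightarrow> module_morphism C To Ta M (\<one> (carr M)) M"
  using modulesD[of M] hat_morphism_Idn R.hat_morphism_Idn by (simp add: module_morphism_iff)

lemma module_morphism_Comp:
  assumes "module_arrow L f M" "module_arrow M g N"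
  shows "module_morphism C To Ta L (g \<cdot> f) N"
  using assms modulesD[of L] modulesD[of M] modulesD[of N]
    hat_morphism_Comp[of "carr L" "act_hat L" f "carr M" "act_hat M" g "carr N" "act_hat N"]
    R.hat_morphism_Comp[of "carr L" "act_check L" f "carr M" "act_check M" g "carr N" "act_check N"]
  by (simp add: module_morphism_iff)

lemma module_morphism_inv:
  assumes "module_arrow M f N" "is_iso C f"
  shows "module_morphism C To Ta N (inv_arr C f) M"
  using assms modulesD[of M] modulesD[of N]
    hat_morphism_inv[of "carr M" "act_hat M" f "carr N" "act_hat N"]
    R.hat_morphism_inv[of "carr M" "act_check M" f "carr N" "act_check N"]
  by (simp add: module_morphism_iff)

lemma module_morphism_tensor:
  assumes "module_arrow M f N" "module_arrow M' g N'"
  shows "module_morphism C To Ta (module_tensor M M') (f \<odot> g) (module_tensor N N')"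
  using assms modulesD[of M] modulesD[of N] modulesD[of M'] modulesD[of N']
    hat_morphism_tensor[of "carr M" "act_hat M" f "carr N" "act_hat N"
      "carr M'" "act_hat M'" g "carr N'" "act_hat N'"]
    R.hat_morphism_tensor[of "carr M'" "act_check M'" g "carr N'" "act_check N'"
      "carr M" "act_check M" f "carr N" "act_check N"]
  by (simp add: module_morphism_iff module_tensor_def)

text \<open>
  The associator of the reversed category is the inverse of \<open>\<a>\<close>, so the mirror image of \<open>hat_morphism_Assoc\<close>
  concerns the inverse of the morphism in question.
\<close>

lemma module_morphism_Assoc:
  assumes "L \<in> modules C To Ta T2h T2c T0" "M \<in> modules C To Ta T2h T2c T0"
    "N \<in> modules C To Ta T2h T2c T0"
  shows "module_morphism C To Ta (module_tensor (module_tensor L M) N) (\<a> (carr L) (carr M) (carr N))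
    (module_tensor L (module_tensor M N))"
proof -
  note L = modulesD[OF assms(1)] and M = modulesD[OF assms(2)] and N = modulesD[OF assms(3)]
  have "R.hat_morphism (carr L \<otimes> carr M \<otimes> carr N) (act_check (module_tensor L (module_tensor M N)))
      (\<a>\<^sup>- (carr L) (carr M) (carr N))
      ((carr L \<otimes> carr M) \<otimes> carr N) (act_check (module_tensor (module_tensor L M) N))"
    using R.hat_morphism_Assoc[OF N(2) M(2) L(2)] by (simp add: module_tensor_def)
  then have "R.hat_morphism ((carr L \<otimes> carr M) \<otimes> carr N)
      (act_check (module_tensor (module_tensor L M) N)) (\<a> (carr L) (carr M) (carr N))
      (carr L \<otimes> carr M \<otimes> carr N) (act_check (module_tensor L (module_tensor M N)))"
    using R.hat_morphism_inv modulesD(2)[of "module_tensor L (module_tensor M N)"]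
      modulesD(2)[of "module_tensor (module_tensor L M) N"] assms L(3) M(3) N(3)
    by fastforce
  then show ?thesis
    using hat_morphism_Assoc[OF L(1) M(1) N(1)] by (simp add: module_morphism_iff module_tensor_def)
qed

lemma module_morphism_unit:
  assumes "M \<in> modules C To Ta T2h T2c T0"
  shows "module_morphism C To Ta (module_tensor module_unit M) (\<l> (carr M)) M"
    "module_morphism C To Ta (module_tensor M module_unit) (\<r> (carr M)) M"
  using hat_morphism_Lunit hat_morphism_Runit R.hat_morphism_Lunit R.hat_morphism_Runit modulesD[OF assms]
  by (simp_all add: module_morphism_iff module_tensor_def module_unit_def)

lemma category_modules: "category module_moncat"
  by standard
    (auto simp: hom_def module_morphism_Arr module_morphism_Idn module_morphism_Comp modulesD)

lemma module_iso:
  assumes "module_arrow M f N" "is_iso C f"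
  shows "is_iso module_moncat (M, f, N)"
  by (rule category.is_isoI[OF category_modules, of _ "(N, inv_arr C f, M)"])
    (use assms module_morphism_inv[OF assms] in \<open>auto simp: module_morphism_Arr\<close>)

lemma unit_natural:
  assumes "module_morphism C To Ta M f N"
  shows "\<l> (carr N) \<cdot> (\<one> \<I> \<odot> f) = f \<cdot> \<l> (carr M)" "\<r> (carr N) \<cdot> (f \<odot> \<one> \<I>) = f \<cdot> \<r> (carr M)"
  using Lunit_natural[of f] Runit_natural[of f] module_morphism_Arr[OF assms] by simp_all

lemma monoidal_category_modules: "monoidal_category module_moncat"
proof (rule monoidal_categoryI)
  show "category module_moncat" by (rule category_modules)
qed (auto simp: unit_natural module_morphism_tensor module_morphism_Assoc module_morphism_unit module_morphism_Arr modulesD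
    interchange Assoc_natural pentagon triangle intro!: module_iso)

lemma strict_monoidal_forget:
  "strict_monoidal_functor module_moncat C forget_obj forget_arr"
proof -
  have "cat_functor module_moncat C forget_obj forget_arr"
    by (rule cat_functorI)
      (auto simp: category_modules category_axioms forget_obj_def forget_arr_def modulesD module_morphism_Arr)
  then show ?thesis
    by (auto simp: strict_monoidal_functor_def strict_monoidal_functor_axioms_def
        monoidal_category_modules monoidal_category_axioms forget_obj_def forget_arr_def)
qed

end

theorem theorem5p5:
  fixes C :: "('o, 'a) moncat" (structure)
    and To :: "'o \<Rightarrow> 'o" and Ta :: "'a \<Rightarrow> 'a"
    and T2h T2c :: "'o \<Rightarrow> 'o \<Rightarrow> 'a" and T0 :: "'a"
  assumes "multiplier_bimonad C To Ta T2h T2c T0"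
    and "split_epi C T0"
    and "\<And>X Y. \<lbrakk> X \<in> Obj C; Y \<in> Obj C \<rbrakk> \<Longrightarrow>
      split_epi C
        ((\<l> (To X) \<odot> \<one> (To Y)) \<cdot> ((T0 \<odot> \<one> (To X)) \<odot> \<one> (To Y)) \<cdot> (T2h \<I> X \<odot> \<one> (To Y))
          \<cdot> (Ta (inv_arr C (\<l> (To X))) \<odot> \<one> (To Y)) \<cdot> T2h (To X) Y)"
    and "\<And>X Y. \<lbrakk> X \<in> Obj C; Y \<in> Obj C \<rbrakk> \<Longrightarrow>
      split_epi C
        ((\<one> (To X) \<odot> \<r> (To Y)) \<cdot> (\<one> (To X) \<odot> (\<one> (To Y) \<odot> T0)) \<cdot> (\<one> (To X) \<odot> T2c Y \<I>)
          \<cdot> (\<one> (To X) \<odot> Ta (inv_arr C (\<r> (To Y)))) \<cdot> T2c X (To Y))"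
  shows "\<exists>M :: (('o, 'a) tmodule, ('o, 'a) tmodule \<times> 'a \<times> ('o, 'a) tmodule) moncat.
      cat.truncate M = module_cat C To Ta T2h T2c T0 \<and>
      monoidal_category M \<and>
      strict_monoidal_functor M C forget_obj forget_arr"
proof -
  interpret multiplier_bimonad C To Ta T2h T2c T0 by (rule assms(1))
  interpret split_multiplier_bimonad C To Ta T2h T2c T0
    by standard (use assms(2,3) in \<open>simp_all add: mult_def\<close>)
  show ?thesis
    using truncate_module_moncat monoidal_category_modules strict_monoidal_forget by blast
qed

end
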